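(* The set of compact metric spaces $X\in\mathfrak{M}$ which contain a $4$-point subspace that cannot be isometrically embedded in the Euclidean space $\mathbb{R}^3$ is open and dense in the Gromov-Hausdorff space $(\mathfrak{M},d_{GH})$. Therefore, a generic compact metric space cannot be isometrically embedded in any Hilbert space, i.e. the set of $X\in\mathfrak{M}$ that admit no isometric embedding into any Hilbert space is residual in $\mathfrak{M}$.
   Context: $\mathfrak{M}$ denotes the Gromov-Hausdorff space: the set of all nonempty compact metric spaces up to isometry, endowed with the Gromov-Hausdorff distance $d_{GH}(X,Y)=\inf d_H^Z(f(X),g(Y))$, where the infimum is over all metric spaces $Z$ and all isometric injections $f:X\to Z$, $g:Y\to Z$, and $d_H^Z$ is the Hausdorff distance between subsets of $Z$. The metric space $\mathfrak{M}$ is complete, hence a Baire space. A subset is rare if its closure has empty interior, meager if it is a countable union of rare sets, and residual if its complement is meager. "A generic compact metric space has property $P$" means that the set of $X\in\mathfrak{M}$ having $P$ is residual in $\mathfrak{M}$. An isometric embedding is a distance-preserving map (not assumed surjective). *)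

theory Defs
  imports "HOL-Analysis.Analysis"
begin

section \<open>Compact metric spaces and isometric embeddings\<close>

definition compact_metric :: "'a metric \<Rightarrow> bool"
  where "compact_metric X \<longleftrightarrow> mspace X \<noteq> {} \<and> compact_space (mtopology_of X)"

definition isometric_embedding :: "'a metric \<Rightarrow> 'b metric \<Rightarrow> ('a \<Rightarrow> 'b) \<Rightarrow> bool"
  where "isometric_embedding X Y f \<longleftrightarrow>
    f \<in> mspace X \<rightarrow> mspace Y \<and>
    (\<forall>x\<in>mspace X. \<forall>x'\<in>mspace X. mdist Y (f x) (f x') = mdist X x x')"

definition embeds_isometrically :: "'a metric \<Rightarrow> 'b metric \<Rightarrow> bool"
  where "embeds_isometrically X Y \<longleftrightarrow> (\<exists>f. isometric_embedding X Y f)"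

definition isometric :: "'a metric \<Rightarrow> 'b metric \<Rightarrow> bool"
  where "isometric X Y \<longleftrightarrow> (\<exists>f. isometric_embedding X Y f \<and> f ` mspace X = mspace Y)"

lemma isometric_embedding_inj:
  assumes "isometric_embedding X Y f"
  shows "inj_on f (mspace X)"
  using assms unfolding isometric_embedding_def inj_on_def
  by (metis Pi_iff mdist_zero)

lemma isometric_embedding_comp:
  assumes "isometric_embedding X Y f" "isometric_embedding Y Z g"
  shows "isometric_embedding X Z (g \<circ> f)"
  using assms unfolding isometric_embedding_def by (auto simp: Pi_iff)

lemma isometric_embedding_mono:
  assumes "isometric_embedding X Y f"
  shows "isometric_embedding (submetric X S) Y f"
  using assms unfolding isometric_embedding_def by auto

lemma isometric_refl: "isometric X X"
  unfolding isometric_def isometric_embedding_def by (rule exI[of _ id]) auto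

lemma isometric_sym:
  assumes "isometric X Y"
  shows "isometric Y X"
proof -
  obtain f where f: "isometric_embedding X Y f" "f ` mspace X = mspace Y"
    using assms unfolding isometric_def by blast
  define g where "g = inv_into (mspace X) f"
  have bij: "bij_betw f (mspace X) (mspace Y)"
    using f isometric_embedding_inj by (auto simp: bij_betw_def)
  have g: "bij_betw g (mspace Y) (mspace X)"
    unfolding g_def by (rule bij_betw_inv_into[OF bij])
  have fg: "f (g y) = y" if "y \<in> mspace Y" for y
    using that f(2) by (simp add: f_inv_into_f g_def)
  have gin: "g y \<in> mspace X" if "y \<in> mspace Y" for y
    using g that by (auto simp: bij_betw_def)
  have "isometric_embedding Y X g"
    unfolding isometric_embedding_def
  proof (intro conjI ballI)
    show "g \<in> mspace Y \<rightarrow> mspace X" using gin by auto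
    fix y y' assume "y \<in> mspace Y" "y' \<in> mspace Y"
    then show "mdist X (g y) (g y') = mdist Y y y'"
      using f(1) fg gin unfolding isometric_embedding_def by metis
  qed
  then show ?thesis
    using g unfolding isometric_def bij_betw_def by blast
qed

lemma isometric_trans:
  assumes "isometric X Y" "isometric Y Z"
  shows "isometric X Z"
proof -
  obtain f g where "isometric_embedding X Y f" "f ` mspace X = mspace Y"
    "isometric_embedding Y Z g" "g ` mspace Y = mspace Z"
    using assms unfolding isometric_def by blast
  then show ?thesis
    unfolding isometric_def using isometric_embedding_comp[of X Y f Z g] image_comp by metis
qed

lemma isometric_imp_embeds: "isometric X Y \<Longrightarrow> embeds_isometrically X Y"
  unfolding isometric_def embeds_isometrically_def by blast

lemma embeds_isometrically_trans:
  "embeds_isometrically X Y \<Longrightarrow> embeds_isometrically Y Z \<Longrightarrow> embeds_isometrically X Z"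
  unfolding embeds_isometrically_def using isometric_embedding_comp by blast

lemma compact_metric_bounded:
  assumes "compact_metric X"
  shows "\<exists>B\<ge>0. \<forall>x\<in>mspace X. \<forall>x'\<in>mspace X. mdist X x x' \<le> B"
proof -
  interpret Metric_space "mspace X" "mdist X" by simp
  have "compactin mtopology (mspace X)"
    using assms unfolding compact_metric_def compact_space_def mtopology_of_def by simp
  then have "mbounded (mspace X)"
    by (rule compactin_imp_mbounded)
  then obtain B where "\<forall>x\<in>mspace X. \<forall>y\<in>mspace X. mdist X x y \<le> B"
    unfolding mbounded_alt by blast
  then show ?thesis
    by (intro exI[of _ "max B 0"]) (auto simp: le_max_iff_disj)
qed

definition transport_metric :: "('a \<Rightarrow> 'b) \<Rightarrow> 'a metric \<Rightarrow> 'b metric"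
  where "transport_metric h X = metric (h ` mspace X,
    \<lambda>u v. mdist X (inv_into (mspace X) h u) (inv_into (mspace X) h v))"

lemma isometric_transport:
  assumes "inj_on h (mspace X)"
  shows "isometric_embedding X (transport_metric h X) h"
    and "mspace (transport_metric h X) = h ` mspace X"
proof -
  interpret T: Metric_space "h ` mspace X"
    "\<lambda>u v. mdist X (inv_into (mspace X) h u) (inv_into (mspace X) h v)"
    using assms
    by unfold_locales (auto simp: mdist_commute intro!: mdist_triangle)
  show "mspace (transport_metric h X) = h ` mspace X"
    unfolding transport_metric_def by simp
  then show "isometric_embedding X (transport_metric h X) h"
    using assms unfolding isometric_embedding_def
    by (auto simp: transport_metric_def)
qed

lemma isometric_compact_metric:
  assumes "isometric X Y" "compact_metric X"
  shows "compact_metric Y"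
proof -
  obtain f where f: "isometric_embedding X Y f" "f ` mspace X = mspace Y"
    using assms unfolding isometric_def by blast
  interpret Metric_space12 "mspace X" "mdist X" "mspace Y" "mdist Y"
    by (simp add: Metric_space12_mspace_mdist)
  have "homeomorphic_map M1.mtopology M2.mtopology f"
    using f isometry_imp_homeomorphic_map[of f] unfolding isometric_embedding_def by auto
  then have "compact_space M1.mtopology \<longleftrightarrow> compact_space M2.mtopology"
    using homeomorphic_compact_space homeomorphic_map_imp_homeomorphic_space by blast
  then show ?thesis
    using assms(2) f(2) unfolding compact_metric_def mtopology_of_def by auto
qed

text \<open>Separable metric spaces have at most continuum many points, so every compact metric space
  is isometric to one whose points are real numbers.\<close>

lemma separable_metric_inj_real:
  fixes X :: "'a metric"
  assumes "countable C" "C \<subseteq> mspace X"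
    and dense: "\<And>x e. x \<in> mspace X \<Longrightarrow> e > 0 \<Longrightarrow> \<exists>c\<in>C. mdist X x c < e"
  obtains h :: "'a \<Rightarrow> real" where "inj_on h (mspace X)"
proof -
  obtain k :: "nat set \<Rightarrow> real" where k: "inj k"
    using nat_sets_eqpoll_reals eqpoll_imp_lepoll unfolding lepoll_def by blast
  define A where "A x = to_nat_on (C \<times> (UNIV::rat set)) ` {(c,q). c \<in> C \<and> mdist X x c < real_of_rat q}" for x
  have inj_c: "inj_on (to_nat_on (C \<times> (UNIV::rat set))) (C \<times> UNIV)"
    using assms(1) by (intro inj_on_to_nat_on) auto
  have "inj_on A (mspace X)"
  proof (rule inj_onI)
    fix x y assume x: "x \<in> mspace X" and y: "y \<in> mspace X" and eq: "A x = A y"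
    have "{(c,q). c \<in> C \<and> mdist X x c < real_of_rat q} = {(c,q). c \<in> C \<and> mdist X y c < real_of_rat q}"
      using eq unfolding A_def by (subst (asm) inj_on_image_eq_iff[OF inj_c]) auto
    then have iff: "mdist X x c < real_of_rat q \<longleftrightarrow> mdist X y c < real_of_rat q" if "c \<in> C" for c q
      using that by (auto simp: set_eq_iff)
    have "mdist X x y \<le> 0"
    proof (rule field_le_epsilon)
      fix e :: real assume "e > 0"
      then obtain c where c: "c \<in> C" "mdist X x c < e/2"
        using dense[OF x, of "e/2"] by auto
      then obtain q where q: "mdist X x c < real_of_rat q" "real_of_rat q < e/2"
        using of_rat_dense by blast
      then have "mdist X y c < e/2"
        using iff[OF c(1), of q] by auto
      moreover have "mdist X x y \<le> mdist X x c + mdist X c y"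
        using x y c assms(2) by (intro mdist_triangle) auto
      ultimately show "mdist X x y \<le> 0 + e"
        using c by (simp add: mdist_commute)
    qed
    then show "x = y"
      using x y by (metis mdist_nonneg mdist_zero order_antisym)
  qed
  then have "inj_on (k \<circ> A) (mspace X)"
    using k by (intro comp_inj_on) (auto intro: inj_on_subset)
  then show ?thesis by (rule that)
qed

lemma compact_metric_dense:
  fixes X :: "'a metric"
  assumes "compact_metric X"
  shows "\<exists>C. countable C \<and> C \<subseteq> mspace X \<and> (\<forall>x\<in>mspace X. \<forall>e>0. \<exists>c\<in>C. mdist X x c < e)"
proof -
  interpret Metric_space "mspace X" "mdist X" by simp
  have "mtotally_bounded (mspace X)"
    using assms unfolding compact_metric_def mtopology_of_def
    by (simp add: compact_space_eq_mcomplete_mtotally_bounded)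
  then have "\<forall>n. \<exists>K. finite K \<and> K \<subseteq> mspace X \<and> mspace X \<subseteq> (\<Union>x\<in>K. mball x (inverse (real (Suc n))))"
    unfolding mtotally_bounded_def by (metis inverse_positive_iff_positive of_nat_0_less_iff zero_less_Suc)
  then obtain K where K: "\<And>n. finite (K n)" "\<And>n. K n \<subseteq> mspace X"
    "\<And>n. mspace X \<subseteq> (\<Union>x\<in>K n. mball x (inverse (real (Suc n))))"
    by metis
  show ?thesis
  proof (intro exI[of _ "\<Union>n. K n"] conjI ballI allI impI)
    show "countable (\<Union>n. K n)" using K(1) by (auto intro: countable_finite)
    show "(\<Union>n. K n) \<subseteq> mspace X" using K(2) by auto
    fix x and e :: real assume x: "x \<in> mspace X" and "e > 0"
    then obtain n where n: "inverse (real (Suc n)) < e"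
      using reals_Archimedean by blast
    obtain c where "c \<in> K n" "mdist X c x < inverse (real (Suc n))"
      using K(3)[of n] x by (auto simp: subset_eq)
    then show "\<exists>c\<in>\<Union>n. K n. mdist X x c < e"
      using n by (auto simp: mdist_commute intro!: bexI[of _ c])
  qed
qed

lemma compact_metric_inj_real:
  fixes X :: "'a metric"
  assumes "compact_metric X"
  obtains h :: "'a \<Rightarrow> real" where "inj_on h (mspace X)"
proof -
  obtain C where C: "countable C" "C \<subseteq> mspace X" "\<forall>x\<in>mspace X. \<forall>e>0. \<exists>c\<in>C. mdist X x c < e"
    using compact_metric_dense[OF assms] by auto
  show ?thesis
    by (rule separable_metric_inj_real[OF C(1,2) _ that]) (use C(3) in auto)
qed

theorem compact_metric_isometric_real:
  fixes X :: "'a metric"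
  assumes "compact_metric X"
  shows "\<exists>Y :: real metric. compact_metric Y \<and> isometric X Y"
proof -
  obtain h :: "'a \<Rightarrow> real" where "inj_on h (mspace X)"
    using compact_metric_inj_real[OF assms] .
  then have "isometric X (transport_metric h X)"
    unfolding isometric_def using isometric_transport by metis
  then show ?thesis
    using isometric_compact_metric assms by blast
qed


section \<open>The Gromov-Hausdorff distance\<close>

definition hausdorff_dist :: "'a metric \<Rightarrow> 'a set \<Rightarrow> 'a set \<Rightarrow> real"
  where "hausdorff_dist Z A B =
    max (SUP a\<in>A. INF b\<in>B. mdist Z a b) (SUP b\<in>B. INF a\<in>A. mdist Z a b)"

text \<open>The infimum ranges over ambient metric spaces \<open>Z\<close> whose points are real numbers. This loses
  nothing: lemma \<open>GH_dist_le_hausdorff_dist\<close> below shows that a \<open>Z\<close> over an arbitrary type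
  cannot make the Hausdorff distance any smaller.\<close>

definition GH_dist :: "real metric \<Rightarrow> real metric \<Rightarrow> real"
  where "GH_dist X Y = Inf {hausdorff_dist Z (f ` mspace X) (g ` mspace Y) | (Z :: real metric) f g.
    isometric_embedding X Z f \<and> isometric_embedding Y Z g}"

text \<open>A coupling is the part \<open>D x y\<close> of a pseudometric on the disjoint union of \<open>X\<close> and \<open>Y\<close>
  extending both metrics, in which each space lies in the \<open>r\<close>-neighbourhood of the other. Such
  functions describe the Gromov-Hausdorff distance without an ambient space.\<close>

definition coupling :: "'a metric \<Rightarrow> 'b metric \<Rightarrow> real \<Rightarrow> ('a \<Rightarrow> 'b \<Rightarrow> real) \<Rightarrow> bool"
  where "coupling X Y r D \<longleftrightarrow>
    (\<forall>x\<in>mspace X. \<forall>y\<in>mspace Y. 0 \<le> D x y) \<and>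
    (\<forall>x\<in>mspace X. \<forall>x'\<in>mspace X. \<forall>y\<in>mspace Y.
        mdist X x x' \<le> D x y + D x' y \<and> D x y \<le> mdist X x x' + D x' y) \<and>
    (\<forall>x\<in>mspace X. \<forall>y\<in>mspace Y. \<forall>y'\<in>mspace Y.
        mdist Y y y' \<le> D x y + D x y' \<and> D x y \<le> D x y' + mdist Y y' y) \<and>
    (\<forall>x\<in>mspace X. \<exists>y\<in>mspace Y. D x y \<le> r) \<and>
    (\<forall>y\<in>mspace Y. \<exists>x\<in>mspace X. D x y \<le> r)"

lemma couplingD:
  assumes "coupling X Y r D"
  shows "\<And>x y. x \<in> mspace X \<Longrightarrow> y \<in> mspace Y \<Longrightarrow> 0 \<le> D x y"
    "\<And>x x' y. x \<in> mspace X \<Longrightarrow> x' \<in> mspace X \<Longrightarrow> y \<in> mspace Y \<Longrightarrow> mdist X x x' \<le> D x y + D x' y"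
    "\<And>x x' y. x \<in> mspace X \<Longrightarrow> x' \<in> mspace X \<Longrightarrow> y \<in> mspace Y \<Longrightarrow> D x y \<le> mdist X x x' + D x' y"
    "\<And>x y y'. x \<in> mspace X \<Longrightarrow> y \<in> mspace Y \<Longrightarrow> y' \<in> mspace Y \<Longrightarrow> mdist Y y y' \<le> D x y + D x y'"
    "\<And>x y y'. x \<in> mspace X \<Longrightarrow> y \<in> mspace Y \<Longrightarrow> y' \<in> mspace Y \<Longrightarrow> D x y \<le> D x y' + mdist Y y' y"
    "\<And>x. x \<in> mspace X \<Longrightarrow> \<exists>y\<in>mspace Y. D x y \<le> r"
    "\<And>y. y \<in> mspace Y \<Longrightarrow> \<exists>x\<in>mspace X. D x y \<le> r"
  using assms unfolding coupling_def by simp_all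

lemma coupling_sym:
  assumes "coupling X Y r D"
  shows "coupling Y X r (\<lambda>y x. D x y)"
  using assms unfolding coupling_def
  by (intro conjI ballI) (simp_all add: mdist_commute[of X] mdist_commute[of Y] add.commute)

lemma coupling_nonneg:
  assumes "coupling X Y r D" "mspace X \<noteq> {}"
  shows "0 \<le> r"
proof -
  obtain x where x: "x \<in> mspace X" using assms(2) by auto
  then obtain y where "y \<in> mspace Y" "D x y \<le> r"
    using couplingD(6)[OF assms(1)] by auto
  then show ?thesis using couplingD(1)[OF assms(1) x] order_trans by auto
qed

lemma SUP_INF_mdist_less:
  assumes A: "A \<subseteq> mspace Z" and B: "B \<subseteq> mspace Z" "B \<noteq> {}"
    and bd: "\<And>a a'. a \<in> A \<Longrightarrow> a' \<in> A \<Longrightarrow> mdist Z a a' \<le> K"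
    and less: "(SUP a\<in>A. INF b\<in>B. mdist Z a b) < r" and a: "a \<in> A"
  shows "\<exists>b\<in>B. mdist Z a b < r"
proof -
  have bb: "bdd_below ((\<lambda>b. mdist Z x b) ` B)" for x
    by (rule bdd_belowI[of _ 0]) auto
  obtain b0 where b0: "b0 \<in> B" using B by blast
  have "bdd_above ((\<lambda>a. INF b\<in>B. mdist Z a b) ` A)"
  proof (rule bdd_aboveI2)
    fix x assume x: "x \<in> A"
    have "(INF b\<in>B. mdist Z x b) \<le> mdist Z x b0"
      by (rule cINF_lower[OF bb b0])
    also have "\<dots> \<le> mdist Z x a + mdist Z a b0"
      using x a b0 A B by (intro mdist_triangle) auto
    also have "\<dots> \<le> K + mdist Z a b0"
      using bd[OF x a] by simp
    finally show "(INF b\<in>B. mdist Z x b) \<le> K + mdist Z a b0" .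
  qed
  then have "(INF b\<in>B. mdist Z a b) < r"
    using less cSUP_upper[OF a] by fastforce
  then show ?thesis
    using cINF_less_iff[OF B(2) bb] by blast
qed

lemma SUP_INF_mdist_le:
  assumes "A \<noteq> {}" and le: "\<And>a. a \<in> A \<Longrightarrow> \<exists>b\<in>B. mdist Z a b \<le> r"
  shows "(SUP a\<in>A. INF b\<in>B. mdist Z a b) \<le> r"
proof (rule cSUP_least[OF assms(1)])
  fix a assume "a \<in> A"
  then obtain b where b: "b \<in> B" "mdist Z a b \<le> r" using le by blast
  have "(INF b\<in>B. mdist Z a b) \<le> mdist Z a b"
    by (rule cINF_lower[OF _ b(1)]) (rule bdd_belowI[of _ 0], auto)
  then show "(INF b\<in>B. mdist Z a b) \<le> r" using b by simp
qed

lemma hausdorff_dist_less_imp_coupling: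
  assumes X: "compact_metric X" and Y: "compact_metric Y"
    and f: "isometric_embedding X Z f" and g: "isometric_embedding Y Z g"
    and less: "hausdorff_dist Z (f ` mspace X) (g ` mspace Y) < r"
  shows "coupling X Y r (\<lambda>x y. mdist Z (f x) (g y))"
proof -
  have fi: "f x \<in> mspace Z" "x \<in> mspace X \<Longrightarrow> x' \<in> mspace X \<Longrightarrow> mdist Z (f x) (f x') = mdist X x x'"
    if "x \<in> mspace X" for x x'
    using f that unfolding isometric_embedding_def by auto
  have gi: "g x \<in> mspace Z" "x \<in> mspace Y \<Longrightarrow> x' \<in> mspace Y \<Longrightarrow> mdist Z (g x) (g x') = mdist Y x x'"
    if "x \<in> mspace Y" for x x'
    using g that unfolding isometric_embedding_def by auto
  have ne: "mspace X \<noteq> {}" "mspace Y \<noteq> {}"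
    using X Y unfolding compact_metric_def by auto
  obtain K where K: "\<forall>x\<in>mspace X. \<forall>x'\<in>mspace X. mdist X x x' \<le> K"
    using compact_metric_bounded[OF X] by auto
  obtain L where L: "\<forall>x\<in>mspace Y. \<forall>x'\<in>mspace Y. mdist Y x x' \<le> L"
    using compact_metric_bounded[OF Y] by auto
  have sub: "f ` mspace X \<subseteq> mspace Z" "g ` mspace Y \<subseteq> mspace Z"
    using fi(1) gi(1) by blast+
  have bd: "mdist Z a a' \<le> K" if "a \<in> f ` mspace X" "a' \<in> f ` mspace X" for a a'
    using that K fi(2) by fastforce
  have bd': "mdist Z a a' \<le> L" if "a \<in> g ` mspace Y" "a' \<in> g ` mspace Y" for a a'
    using that L gi(2) by fastforce
  have less1: "(SUP a\<in>f ` mspace X. INF b\<in>g ` mspace Y. mdist Z a b) < r"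
    and less2: "(SUP b\<in>g ` mspace Y. INF a\<in>f ` mspace X. mdist Z a b) < r"
    using less unfolding hausdorff_dist_def max_less_iff_conj by blast+
  have l1: "\<exists>b\<in>g ` mspace Y. mdist Z a b < r" if "a \<in> f ` mspace X" for a
    using SUP_INF_mdist_less[OF sub _ bd less1 that] ne by blast
  have l2: "\<exists>b\<in>f ` mspace X. mdist Z a b < r" if "a \<in> g ` mspace Y" for a
    using SUP_INF_mdist_less[OF sub(2,1) _ bd' _ that, of r] less2 ne
    by (simp add: mdist_commute)
  show ?thesis
    unfolding coupling_def
  proof (intro conjI ballI)
    fix x x' y assume *: "x \<in> mspace X" "x' \<in> mspace X" "y \<in> mspace Y"
    show "mdist X x x' \<le> mdist Z (f x) (g y) + mdist Z (f x') (g y)"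
      using mdist_triangle[of "f x" Z "g y" "f x'"] * fi gi by (simp add: mdist_commute)
    show "mdist Z (f x) (g y) \<le> mdist X x x' + mdist Z (f x') (g y)"
      using mdist_triangle[of "f x" Z "f x'" "g y"] * fi gi by simp
  next
    fix x y y' assume *: "x \<in> mspace X" "y \<in> mspace Y" "y' \<in> mspace Y"
    show "mdist Y y y' \<le> mdist Z (f x) (g y) + mdist Z (f x) (g y')"
      using mdist_triangle[of "g y" Z "f x" "g y'"] * fi gi by (simp add: mdist_commute)
    show "mdist Z (f x) (g y) \<le> mdist Z (f x) (g y') + mdist Y y' y"
      using mdist_triangle[of "f x" Z "g y'" "g y"] * fi gi by simp
  next
    fix x assume "x \<in> mspace X"
    then show "\<exists>y\<in>mspace Y. mdist Z (f x) (g y) \<le> r"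
      using l1[of "f x"] by force
  next
    fix y assume "y \<in> mspace Y"
    then show "\<exists>x\<in>mspace X. mdist Z (f x) (g y) \<le> r"
      using l2[of "g y"] by (force simp: mdist_commute)
  qed auto
qed

text \<open>A coupling, made positive, extends to a metric on the disjoint union.\<close>

lemma coupling_imp_hausdorff_dist_le:
  fixes X Y :: "real metric"
  assumes ne: "mspace X \<noteq> {}" "mspace Y \<noteq> {}" and D: "coupling X Y r D" and e: "e > 0"
  obtains Z :: "real metric" and f g where "isometric_embedding X Z f" "isometric_embedding Y Z g"
    "hausdorff_dist Z (f ` mspace X) (g ` mspace Y) \<le> r + e"
proof -
  define S where "S = Inl ` mspace X \<union> Inr ` mspace Y"
  define d where "d u v = (case u of
      Inl x \<Rightarrow> (case v of Inl x' \<Rightarrow> mdist X x x' | Inr y \<Rightarrow> \<bar>D x y\<bar> + e)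
    | Inr y \<Rightarrow> (case v of Inl x' \<Rightarrow> \<bar>D x' y\<bar> + e | Inr y' \<Rightarrow> mdist Y y y'))" for u v
  note cD = couplingD[OF D]
  have abs_D: "\<bar>D x y\<bar> = D x y" if "x \<in> mspace X" "y \<in> mspace Y" for x y
    using cD(1)[OF that] by simp
  have Dpos: "0 < D x y + e" if "x \<in> mspace X" "y \<in> mspace Y" for x y
    using cD(1)[OF that] e by simp
  interpret Metric_space S d
  proof
    show "0 \<le> d u v" for u v
      using e by (cases u; cases v) (simp_all add: d_def)
    show "d u v = d v u" for u v
      by (cases u; cases v) (simp_all add: d_def mdist_commute)
    show "d u v = 0 \<longleftrightarrow> u = v" if "u \<in> S" "v \<in> S" for u v
    proof -
      have "\<bar>D x y\<bar> + e \<noteq> 0" for x y using e by (simp add: add_nonneg_eq_0_iff)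
      then show ?thesis
        using that by (auto simp: S_def d_def)
    qed
    show "d u w \<le> d u v + d v w" if "u \<in> S" "v \<in> S" "w \<in> S" for u v w
    proof (cases u; cases v; cases w)
      fix x y z assume eq: "u = Inl x" "v = Inl y" "w = Inl z"
      then have "x \<in> mspace X" "y \<in> mspace X" "z \<in> mspace X" using that by (auto simp: S_def)
      then show ?thesis by (simp add: eq d_def mdist_triangle)
    next
      fix x y z assume eq: "u = Inl x" "v = Inl y" "w = Inr z"
      then have "x \<in> mspace X" "y \<in> mspace X" "z \<in> mspace Y" using that by (auto simp: S_def)
      then show ?thesis using cD(3)[of x y z] by (simp add: eq d_def abs_D)
    next
      fix x y z assume eq: "u = Inl x" "v = Inr y" "w = Inl z"
      then have "x \<in> mspace X" "y \<in> mspace Y" "z \<in> mspace X" using that by (auto simp: S_def)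
      then show ?thesis using cD(2)[of x z y] e by (simp add: eq d_def abs_D)
    next
      fix x y z assume eq: "u = Inl x" "v = Inr y" "w = Inr z"
      then have "x \<in> mspace X" "y \<in> mspace Y" "z \<in> mspace Y" using that by (auto simp: S_def)
      then show ?thesis using cD(5)[of x z y] by (simp add: eq d_def abs_D)
    next
      fix x y z assume eq: "u = Inr x" "v = Inl y" "w = Inl z"
      then have "x \<in> mspace Y" "y \<in> mspace X" "z \<in> mspace X" using that by (auto simp: S_def)
      then show ?thesis using cD(3)[of z y x] by (simp add: eq d_def abs_D mdist_commute)
    next
      fix x y z assume eq: "u = Inr x" "v = Inl y" "w = Inr z"
      then have "x \<in> mspace Y" "y \<in> mspace X" "z \<in> mspace Y" using that by (auto simp: S_def)
      then show ?thesis using cD(4)[of y x z] e by (simp add: eq d_def abs_D)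
    next
      fix x y z assume eq: "u = Inr x" "v = Inr y" "w = Inl z"
      then have "x \<in> mspace Y" "y \<in> mspace Y" "z \<in> mspace X" using that by (auto simp: S_def)
      then show ?thesis using cD(5)[of z x y] by (simp add: eq d_def abs_D mdist_commute)
    next
      fix x y z assume eq: "u = Inr x" "v = Inr y" "w = Inr z"
      then have "x \<in> mspace Y" "y \<in> mspace Y" "z \<in> mspace Y" using that by (auto simp: S_def)
      then show ?thesis by (simp add: eq d_def mdist_triangle)
    qed
  qed
  define W where "W = metric (S, d)"
  have W: "mspace W = S" "mdist W = d" by (simp_all add: W_def)
  define h :: "real + real \<Rightarrow> real" where "h = case_sum exp (\<lambda>y. - exp y)"
  have "h u \<noteq> h v" if "u \<noteq> v" for u v
  proof -
    have "exp x \<noteq> - exp y" "- exp x \<noteq> exp y" for x y :: real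
      using exp_gt_zero[of x] exp_gt_zero[of y] by linarith+
    then show ?thesis
      using that by (cases u; cases v) (simp_all add: h_def)
  qed
  then have "inj_on h (mspace W)" by (meson inj_onI)
  note hW = isometric_transport[OF this]
  define Z where "Z = transport_metric h W"
  have hZ: "mdist Z (h u) (h v) = d u v" if "u \<in> S" "v \<in> S" for u v
    using that hW unfolding isometric_embedding_def by (simp add: Z_def W)
  have Inl: "isometric_embedding X W Inl"
    unfolding isometric_embedding_def by (auto simp: W S_def d_def)
  have Inr: "isometric_embedding Y W Inr"
    unfolding isometric_embedding_def by (auto simp: W S_def d_def)
  show ?thesis
  proof (rule that)
    show "isometric_embedding X Z (h \<circ> Inl)" "isometric_embedding Y Z (h \<circ> Inr)"
      using hW(1) Inl Inr isometric_embedding_comp unfolding Z_def by blast+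
    have eq: "mdist Z (h (Inl x)) (h (Inr y)) = D x y + e" if "x \<in> mspace X" "y \<in> mspace Y" for x y
    proof -
      have "mdist Z (h (Inl x)) (h (Inr y)) = d (Inl x) (Inr y)"
        using that by (intro hZ) (auto simp: S_def)
      then show ?thesis using that by (simp add: d_def abs_D)
    qed
    have "(SUP a\<in>(h \<circ> Inl) ` mspace X. INF b\<in>(h \<circ> Inr) ` mspace Y. mdist Z a b) \<le> r + e"
    proof (rule SUP_INF_mdist_le)
      fix a assume "a \<in> (h \<circ> Inl) ` mspace X"
      then obtain x where x: "x \<in> mspace X" "a = h (Inl x)" by auto
      then obtain y where y: "y \<in> mspace Y" "D x y \<le> r" using cD(6) by blast
      show "\<exists>b\<in>(h \<circ> Inr) ` mspace Y. mdist Z a b \<le> r + e"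
        using x y eq by (intro bexI[of _ "h (Inr y)"]) auto
    qed (use ne in simp)
    moreover have "(SUP b\<in>(h \<circ> Inr) ` mspace Y. INF a\<in>(h \<circ> Inl) ` mspace X. mdist Z b a) \<le> r + e"
    proof (rule SUP_INF_mdist_le)
      fix a assume "a \<in> (h \<circ> Inr) ` mspace Y"
      then obtain y where y: "y \<in> mspace Y" "a = h (Inr y)" by auto
      then obtain x where x: "x \<in> mspace X" "D x y \<le> r" using cD(7) by blast
      show "\<exists>b\<in>(h \<circ> Inl) ` mspace X. mdist Z a b \<le> r + e"
        using x y eq by (intro bexI[of _ "h (Inl x)"]) (auto simp: mdist_commute)
    qed (use ne in simp)
    ultimately show "hausdorff_dist Z ((h \<circ> Inl) ` mspace X) ((h \<circ> Inr) ` mspace Y) \<le> r + e"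
      by (simp add: hausdorff_dist_def mdist_commute)
  qed
qed


lemma coupling_const:
  assumes "mspace X \<noteq> {}" "mspace Y \<noteq> {}" "B \<ge> 0"
    and "\<forall>x\<in>mspace X. \<forall>x'\<in>mspace X. mdist X x x' \<le> B"
    and "\<forall>y\<in>mspace Y. \<forall>y'\<in>mspace Y. mdist Y y y' \<le> B"
  shows "coupling X Y B (\<lambda>_ _. B)"
proof -
  have "mdist X x x' \<le> B + B" if "x \<in> mspace X" "x' \<in> mspace X" for x x'
    using assms(3,4) that by (intro add_increasing2) simp_all
  moreover have "mdist Y y y' \<le> B + B" if "y \<in> mspace Y" "y' \<in> mspace Y" for y y'
    using assms(3,5) that by (intro add_increasing2) simp_all
  ultimately show ?thesis
    using assms(1-3) by (simp add: coupling_def ex_in_conv)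
qed

lemma coupling_exists:
  assumes "compact_metric X" "compact_metric Y"
  shows "\<exists>r D. coupling X Y r D"
proof -
  obtain B C where *: "B \<ge> 0" "\<forall>x\<in>mspace X. \<forall>x'\<in>mspace X. mdist X x x' \<le> B"
    "\<forall>y\<in>mspace Y. \<forall>y'\<in>mspace Y. mdist Y y y' \<le> C"
    using compact_metric_bounded assms by metis
  have "coupling X Y (max B C) (\<lambda>_ _. max B C)"
    using assms * unfolding compact_metric_def
    by (intro coupling_const) (auto simp: le_max_iff_disj)
  then show ?thesis by blast
qed

lemma hausdorff_dist_nonneg:
  assumes "compact_metric X" "compact_metric Y"
    and "isometric_embedding X Z f" "isometric_embedding Y Z g"
  shows "0 \<le> hausdorff_dist Z (f ` mspace X) (g ` mspace Y)"
proof (rule ccontr)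
  assume "\<not> ?thesis"
  then obtain r where "hausdorff_dist Z (f ` mspace X) (g ` mspace Y) < r" "r < 0"
    using dense by (auto simp: not_le)
  then show False
    using coupling_nonneg[OF hausdorff_dist_less_imp_coupling[OF assms]] assms(1)
    unfolding compact_metric_def by fastforce
qed

lemma coupling_imp_GH_dist_le:
  assumes "compact_metric X" "compact_metric Y" and D: "coupling X Y r D"
  shows "GH_dist X Y \<le> r"
proof (rule field_le_epsilon)
  fix e :: real assume "e > 0"
  then obtain Z :: "real metric" and f g where Z: "isometric_embedding X Z f" "isometric_embedding Y Z g"
    "hausdorff_dist Z (f ` mspace X) (g ` mspace Y) \<le> r + e"
    using coupling_imp_hausdorff_dist_le[OF _ _ D] assms(1,2) unfolding compact_metric_def by metis
  have "GH_dist X Y \<le> hausdorff_dist Z (f ` mspace X) (g ` mspace Y)"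
    unfolding GH_dist_def using Z(1,2) hausdorff_dist_nonneg[OF assms(1,2)]
    by (intro cInf_lower) (auto intro!: bdd_belowI[of _ 0])
  then show "GH_dist X Y \<le> r + e" using Z(3) by simp
qed

lemma GH_dist_less_imp_coupling:
  assumes "compact_metric X" "compact_metric Y" and less: "GH_dist X Y < r"
  shows "\<exists>D. coupling X Y r D"
proof -
  let ?S = "{hausdorff_dist Z (f ` mspace X) (g ` mspace Y) | (Z :: real metric) f g.
    isometric_embedding X Z f \<and> isometric_embedding Y Z g}"
  obtain s D where sD: "coupling X Y s D"
    using coupling_exists[OF assms(1,2)] by blast
  have ne: "mspace X \<noteq> {}" "mspace Y \<noteq> {}"
    using assms(1,2) unfolding compact_metric_def by auto
  obtain Z :: "real metric" and f g where "isometric_embedding X Z f" "isometric_embedding Y Z g"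
    using coupling_imp_hausdorff_dist_le[OF ne sD zero_less_one] by metis
  then have "?S \<noteq> {}" by blast
  then obtain t where "t \<in> ?S" and t: "t < r"
    using cInf_lessD[of ?S r] less unfolding GH_dist_def by auto
  then obtain Z :: "real metric" and f g where "t = hausdorff_dist Z (f ` mspace X) (g ` mspace Y)"
    "isometric_embedding X Z f" "isometric_embedding Y Z g"
    by auto
  then show ?thesis
    using hausdorff_dist_less_imp_coupling[OF assms(1,2), of Z f g r] t by auto
qed

theorem GH_dist_le_hausdorff_dist:
  fixes Z :: "'z metric"
  assumes "compact_metric X" "compact_metric Y"
    and "isometric_embedding X Z f" "isometric_embedding Y Z g"
  shows "GH_dist X Y \<le> hausdorff_dist Z (f ` mspace X) (g ` mspace Y)"
proof (rule dense_ge)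
  fix r assume "hausdorff_dist Z (f ` mspace X) (g ` mspace Y) < r"
  then show "GH_dist X Y \<le> r"
    by (rule coupling_imp_GH_dist_le[OF assms(1,2) hausdorff_dist_less_imp_coupling[OF assms]])
qed

lemma GH_dist_nonneg:
  assumes "compact_metric X" "compact_metric Y"
  shows "0 \<le> GH_dist X Y"
proof (rule ccontr)
  assume "\<not> ?thesis"
  then obtain r where "GH_dist X Y < r" "r < 0"
    using dense by (auto simp: not_le)
  then obtain D where "coupling X Y r D"
    using GH_dist_less_imp_coupling[OF assms] by blast
  then show False
    using coupling_nonneg \<open>r < 0\<close> assms unfolding compact_metric_def by fastforce
qed

lemma GH_dist_commute:
  assumes "compact_metric X" "compact_metric Y"
  shows "GH_dist X Y = GH_dist Y X"
proof -
  have "GH_dist Y X \<le> GH_dist X Y" if c: "compact_metric X" "compact_metric Y" for X Y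
  proof (rule dense_ge)
    fix r assume "GH_dist X Y < r"
    then obtain D where "coupling X Y r D" using GH_dist_less_imp_coupling[OF c] by blast
    then show "GH_dist Y X \<le> r"
      by (rule coupling_imp_GH_dist_le[OF c(2,1) coupling_sym])
  qed
  then show ?thesis using assms by (simp add: order_antisym)
qed

lemma coupling_isometric:
  assumes "isometric X Y"
  shows "\<exists>D. coupling X Y 0 D"
proof -
  obtain f where f: "isometric_embedding X Y f" "f ` mspace X = mspace Y"
    using assms unfolding isometric_def by blast
  have fi: "f x \<in> mspace Y" if "x \<in> mspace X" for x
    using f(2) that by blast
  have fd: "mdist X x x' = mdist Y (f x) (f x')" if "x \<in> mspace X" "x' \<in> mspace X" for x x'
    using f(1) that unfolding isometric_embedding_def by simp
  have "coupling X Y 0 (\<lambda>x y. mdist Y (f x) y)"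
    unfolding coupling_def
  proof (intro conjI ballI)
    fix x x' y assume *: "x \<in> mspace X" "x' \<in> mspace X" "y \<in> mspace Y"
    show "mdist X x x' \<le> mdist Y (f x) y + mdist Y (f x') y"
      using mdist_triangle[of "f x" Y y "f x'"] * fi fd by (simp add: mdist_commute)
    show "mdist Y (f x) y \<le> mdist X x x' + mdist Y (f x') y"
      using mdist_triangle[of "f x" Y "f x'" y] * fi fd by simp
  next
    fix x y y' assume *: "x \<in> mspace X" "y \<in> mspace Y" "y' \<in> mspace Y"
    show "mdist Y y y' \<le> mdist Y (f x) y + mdist Y (f x) y'"
      using mdist_triangle[of y Y "f x" y'] * fi by (simp add: mdist_commute)
    show "mdist Y (f x) y \<le> mdist Y (f x) y' + mdist Y y' y"
      using mdist_triangle[of "f x" Y y' y] * fi by simp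
  next
    fix x assume x: "x \<in> mspace X"
    have "mdist Y (f x) (f x) = 0" using fi[OF x] by simp
    then show "\<exists>y\<in>mspace Y. mdist Y (f x) y \<le> 0"
      by (metis fi[OF x] order_refl)
  next
    fix y assume "y \<in> mspace Y"
    then obtain x where x: "x \<in> mspace X" "y = f x" using f(2) by blast
    have "mdist Y (f x) y = 0" using fi[OF x(1)] x(2) by simp
    then show "\<exists>x\<in>mspace X. mdist Y (f x) y \<le> 0"
      by (metis x(1) order_refl)
  qed auto
  then show ?thesis by blast
qed

lemma coupling_trans:
  assumes ne: "mspace Y \<noteq> {}" and D: "coupling X Y r D" and E: "coupling Y Z s E"
  shows "coupling X Z (r + s) (\<lambda>x z. INF y\<in>mspace Y. D x y + E y z)"
proof -
  note cD = couplingD[OF D] and cE = couplingD[OF E]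
  let ?F = "\<lambda>x z. INF y\<in>mspace Y. D x y + E y z"
  have bdd: "bdd_below ((\<lambda>y. D x y + E y z) ` mspace Y)" if "x \<in> mspace X" "z \<in> mspace Z" for x z
    using that cD(1) cE(1) by (intro bdd_belowI2[of _ 0]) (simp add: add_nonneg_nonneg)
  have lower: "?F x z \<le> D x y + E y z" if "x \<in> mspace X" "y \<in> mspace Y" "z \<in> mspace Z" for x y z
    using cINF_lower[OF bdd[OF that(1,3)] that(2)] .
  have upper: "c \<le> ?F x z" if "\<And>y. y \<in> mspace Y \<Longrightarrow> c \<le> D x y + E y z" for c x z
    using cINF_greatest[OF ne that] .
  show ?thesis
    unfolding coupling_def
  proof (intro conjI ballI)
    fix x z assume "x \<in> mspace X" "z \<in> mspace Z"
    then show "0 \<le> ?F x z" using cD(1) cE(1) by (intro upper) simp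
  next
    fix x x' z assume *: "x \<in> mspace X" "x' \<in> mspace X" "z \<in> mspace Z"
    have "mdist X x x' - ?F x' z \<le> ?F x z"
    proof (rule upper)
      fix y assume y: "y \<in> mspace Y"
      have "mdist X x x' - (D x y + E y z) \<le> ?F x' z"
      proof (rule upper)
        fix y' assume y': "y' \<in> mspace Y"
        show "mdist X x x' - (D x y + E y z) \<le> D x' y' + E y' z"
          using cD(2)[OF *(1,2) y] cD(5)[OF *(2) y y'] cE(2)[OF y' y *(3)] by simp
      qed
      then show "mdist X x x' - ?F x' z \<le> D x y + E y z" by simp
    qed
    then show "mdist X x x' \<le> ?F x z + ?F x' z" by simp
    have "?F x z - mdist X x x' \<le> ?F x' z"
    proof (rule upper)
      fix y assume y: "y \<in> mspace Y"
      show "?F x z - mdist X x x' \<le> D x' y + E y z"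
        using lower[OF *(1) y *(3)] cD(3)[OF *(1,2) y] by simp
    qed
    then show "?F x z \<le> mdist X x x' + ?F x' z" by simp
  next
    fix x z z' assume *: "x \<in> mspace X" "z \<in> mspace Z" "z' \<in> mspace Z"
    have "mdist Z z z' - ?F x z' \<le> ?F x z"
    proof (rule upper)
      fix y assume y: "y \<in> mspace Y"
      have "mdist Z z z' - (D x y + E y z) \<le> ?F x z'"
      proof (rule upper)
        fix y' assume y': "y' \<in> mspace Y"
        show "mdist Z z z' - (D x y + E y z) \<le> D x y' + E y' z'"
          using cE(4)[OF y *(2,3)] cE(3)[OF y y' *(3)] cD(4)[OF *(1) y y'] by simp
      qed
      then show "mdist Z z z' - ?F x z' \<le> D x y + E y z" by simp
    qed
    then show "mdist Z z z' \<le> ?F x z + ?F x z'" by simp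
    have "?F x z - mdist Z z' z \<le> ?F x z'"
    proof (rule upper)
      fix y assume y: "y \<in> mspace Y"
      show "?F x z - mdist Z z' z \<le> D x y + E y z'"
        using lower[OF *(1) y *(2)] cE(5)[OF y *(2,3)] by simp
    qed
    then show "?F x z \<le> ?F x z' + mdist Z z' z" by simp
  next
    fix x assume x: "x \<in> mspace X"
    then obtain y where y: "y \<in> mspace Y" "D x y \<le> r" using cD(6) by blast
    then obtain z where z: "z \<in> mspace Z" "E y z \<le> s" using cE(6) by blast
    show "\<exists>z\<in>mspace Z. ?F x z \<le> r + s"
      using lower[OF x y(1) z(1)] y z by (intro bexI[of _ z]) auto
  next
    fix z assume z: "z \<in> mspace Z"
    then obtain y where y: "y \<in> mspace Y" "E y z \<le> s" using cE(7) by blast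
    then obtain x where x: "x \<in> mspace X" "D x y \<le> r" using cD(7) by blast
    show "\<exists>x\<in>mspace X. ?F x z \<le> r + s"
      using lower[OF x(1) y(1) z] x y by (intro bexI[of _ x]) auto
  qed
qed

lemma GH_dist_triangle:
  assumes "compact_metric X" "compact_metric Y" "compact_metric Z"
  shows "GH_dist X Z \<le> GH_dist X Y + GH_dist Y Z"
proof (rule field_le_epsilon)
  fix e :: real assume "e > 0"
  then obtain D E where "coupling X Y (GH_dist X Y + e/2) D" "coupling Y Z (GH_dist Y Z + e/2) E"
    using GH_dist_less_imp_coupling[of X Y "GH_dist X Y + e/2"]
      GH_dist_less_imp_coupling[of Y Z "GH_dist Y Z + e/2"] assms by auto
  then have "coupling X Z (GH_dist X Y + e/2 + (GH_dist Y Z + e/2))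
      (\<lambda>x z. INF y\<in>mspace Y. D x y + E y z)"
    using assms(2) unfolding compact_metric_def by (intro coupling_trans) auto
  from coupling_imp_GH_dist_le[OF assms(1,3) this]
  show "GH_dist X Z \<le> GH_dist X Y + GH_dist Y Z + e" by simp
qed

lemma isometric_imp_GH_dist_0:
  assumes "compact_metric X" "compact_metric Y" "isometric X Y"
  shows "GH_dist X Y = 0"
proof -
  obtain D where "coupling X Y 0 D" using coupling_isometric[OF assms(3)] by auto
  then show ?thesis
    using coupling_imp_GH_dist_le[OF assms(1,2)] GH_dist_nonneg[OF assms(1,2)] order_antisym by auto
qed

lemma GH_dist_cong:
  assumes "compact_metric X" "compact_metric X'" "compact_metric Y" "compact_metric Y'"
    and "isometric X X'" "isometric Y Y'"
  shows "GH_dist X Y = GH_dist X' Y'"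
proof -
  have "GH_dist X Y \<le> GH_dist X' Y'"
    if c: "compact_metric X" "compact_metric X'" "compact_metric Y" "compact_metric Y'"
    and i: "isometric X X'" "isometric Y Y'" for X X' Y Y'
    using GH_dist_triangle[OF c(1,2,3)] GH_dist_triangle[OF c(2,4,3)]
      isometric_imp_GH_dist_0[OF c(1,2) i(1)]
      isometric_imp_GH_dist_0[OF c(4,3) isometric_sym[OF i(2)]] by simp
  then show ?thesis
    using assms isometric_sym order_antisym by meson
qed

lemma GH_dist_0_imp_isometric:
  assumes X: "compact_metric X" and Y: "compact_metric Y" and 0: "GH_dist X Y = 0"
  shows "isometric X Y"
proof -
  define T where "T = prod_topology (product_topology (\<lambda>_. mtopology_of Y) (mspace X))
    (product_topology (\<lambda>_. mtopology_of X) (mspace Y))"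
  define C where "C n = {p \<in> topspace T. \<forall>x\<in>mspace X. \<forall>y\<in>mspace Y.
    \<bar>mdist Y (fst p x) y - mdist X x (snd p y)\<bar> \<le> 2 * inverse (real (Suc n))}" for n
  have comp: "compact_space T"
    using X Y unfolding T_def compact_metric_def
    by (auto simp: compact_space_prod_topology compact_space_product_topology)
  have "closedin T (C n)" for n
  proof -
    have "closedin T {p \<in> topspace T. \<bar>mdist Y (fst p x) y - mdist X x (snd p y)\<bar>
        \<in> {..2 * inverse (real (Suc n))}}" if "x \<in> mspace X" "y \<in> mspace Y" for x y
    proof (rule closedin_continuous_map_preimage)
      have "continuous_map T (mtopology_of Y) ((\<lambda>f. f x) \<circ> fst)"
        unfolding T_def using that
        by (intro continuous_map_compose[OF continuous_map_fst] continuous_map_product_projection)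
      moreover have "continuous_map T (mtopology_of X) ((\<lambda>f. f y) \<circ> snd)"
        unfolding T_def using that
        by (intro continuous_map_compose[OF continuous_map_snd] continuous_map_product_projection)
      ultimately show "continuous_map T euclideanreal (\<lambda>p. \<bar>mdist Y (fst p x) y - mdist X x (snd p y)\<bar>)"
        using that
        by (intro continuous_map_real_abs continuous_map_diff continuous_map_mdist) (auto simp: o_def)
    qed simp
    then have "closedin T (topspace T \<inter> (\<Inter>x\<in>mspace X. topspace T \<inter> (\<Inter>y\<in>mspace Y. {p \<in> topspace T.
        \<bar>mdist Y (fst p x) y - mdist X x (snd p y)\<bar> \<in> {..2 * inverse (real (Suc n))}})))"
      using X Y unfolding compact_metric_def
      by (intro closedin_Int closedin_topspace closedin_INT) auto
    moreover have "(topspace T \<inter> (\<Inter>x\<in>mspace X. topspace T \<inter> (\<Inter>y\<in>mspace Y. {p \<in> topspace T.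
        \<bar>mdist Y (fst p x) y - mdist X x (snd p y)\<bar> \<in> {..2 * inverse (real (Suc n))}}))) = C n"
      unfolding C_def using X Y unfolding compact_metric_def by auto
    ultimately show ?thesis by simp
  qed
  moreover have "C n \<noteq> {}" for n
  proof -
    have "GH_dist X Y < inverse (real (Suc n))" using 0 by simp
    then obtain D where D: "coupling X Y (inverse (real (Suc n))) D"
      using GH_dist_less_imp_coupling[OF X Y] by blast
    note cD = couplingD[OF D]
    obtain f where f: "\<And>x. x \<in> mspace X \<Longrightarrow> f x \<in> mspace Y \<and> D x (f x) \<le> inverse (real (Suc n))"
      using cD(6) by metis
    obtain g where g: "\<And>y. y \<in> mspace Y \<Longrightarrow> g y \<in> mspace X \<and> D (g y) y \<le> inverse (real (Suc n))"
      using cD(7) by metis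
    have "(restrict f (mspace X), restrict g (mspace Y)) \<in> C n"
      unfolding C_def
    proof (intro CollectI conjI ballI)
      show "(restrict f (mspace X), restrict g (mspace Y)) \<in> topspace T"
        using f g by (auto simp: T_def)
      fix x y assume x: "x \<in> mspace X" and y: "y \<in> mspace Y"
      have fx: "f x \<in> mspace Y" and gy: "g y \<in> mspace X"
        and le: "D x (f x) \<le> inverse (real (Suc n))" "D (g y) y \<le> inverse (real (Suc n))"
        using f[OF x] g[OF y] by auto
      have "mdist Y (f x) y \<le> D x (f x) + D x y" "D x y \<le> mdist X x (g y) + D (g y) y"
        "mdist X x (g y) \<le> D x y + D (g y) y" "D x y \<le> D x (f x) + mdist Y (f x) y"
        using cD(4)[OF x fx y] cD(3)[OF x gy y] cD(2)[OF x gy y] cD(5)[OF x y fx] by auto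
      then have "\<bar>mdist Y (f x) y - mdist X x (g y)\<bar> \<le> 2 * inverse (real (Suc n))"
        using le by linarith
      then show "\<bar>mdist Y (fst (restrict f (mspace X), restrict g (mspace Y)) x) y -
          mdist X x (snd (restrict f (mspace X), restrict g (mspace Y)) y)\<bar>
          \<le> 2 * inverse (real (Suc n))"
        using x y by simp
    qed
    then show ?thesis by blast
  qed
  moreover have "decseq C"
  proof (rule decseq_SucI)
    fix n
    have "2 * inverse (real (Suc (Suc n))) \<le> 2 * inverse (real (Suc n))"
      by (simp add: field_simps)
    then show "C (Suc n) \<subseteq> C n"
      unfolding C_def by (blast intro: order_trans)
  qed
  ultimately have "(\<Inter>n. C n) \<noteq> {}"
    by (rule compact_space_imp_nest[OF comp])
  then obtain f g where p: "\<And>n. (f, g) \<in> C n" by auto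
  have fin: "f \<in> mspace X \<rightarrow> mspace Y" and gin: "g \<in> mspace Y \<rightarrow> mspace X"
    using p[of 0] by (auto simp: C_def T_def PiE_def)
  have eq: "mdist Y (f x) y = mdist X x (g y)" if "x \<in> mspace X" "y \<in> mspace Y" for x y
  proof -
    have le: "\<bar>mdist Y (f x) y - mdist X x (g y)\<bar> / 2 \<le> inverse (real (Suc n))" for n
    proof -
      have "\<bar>mdist Y (f x) y - mdist X x (g y)\<bar> \<le> 2 * inverse (real (Suc n))"
        using p[of n] that unfolding C_def mem_Collect_eq fst_conv snd_conv by blast
      moreover have "a \<le> 2 * k \<Longrightarrow> a / 2 \<le> k" for a k :: real by simp
      ultimately show ?thesis by blast
    qed
    then have "\<bar>mdist Y (f x) y - mdist X x (g y)\<bar> / 2 \<le> 0"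
      using reals_Archimedean by (metis linorder_not_le)
    then show ?thesis by simp
  qed
  have gf: "g (f x) = x" if x: "x \<in> mspace X" for x
  proof -
    have fx: "f x \<in> mspace Y" and gfx: "g (f x) \<in> mspace X"
      using fin gin x by auto
    have "mdist Y (f x) (f x) = 0" using fx by simp
    then have "mdist X x (g (f x)) = 0" using eq[OF x fx] by metis
    then show ?thesis using mdist_zero[OF x gfx] by metis
  qed
  have fg: "f (g y) = y" if y: "y \<in> mspace Y" for y
  proof -
    have gy: "g y \<in> mspace X" and fgy: "f (g y) \<in> mspace Y"
      using fin gin y by auto
    have "mdist X (g y) (g y) = 0" using gy by simp
    then have "mdist Y (f (g y)) y = 0" using eq[OF gy y] by metis
    then show ?thesis using mdist_zero[OF fgy y] by metis
  qed
  have "isometric_embedding X Y f"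
    unfolding isometric_embedding_def using fin gin gf eq by (auto simp: Pi_iff)
  moreover have "f ` mspace X = mspace Y"
    using fin gin fg by force
  ultimately show ?thesis unfolding isometric_def by blast
qed


section \<open>The Gromov-Hausdorff space\<close>

text \<open>Every compact metric space is isometric to one with real points
  (\<open>compact_metric_isometric_real\<close>), so this quotient contains all isometry classes of nonempty
  compact metric spaces.\<close>

quotient_type gh_space = "real metric" / partial: "\<lambda>X Y. compact_metric X \<and> compact_metric Y \<and> isometric X Y"
proof (rule part_equivpI)
  have "mspace (submetric (euclidean_metric :: real metric) {0}) = {0}" by simp
  then have "compact_metric (submetric (euclidean_metric :: real metric) {0})"
    unfolding compact_metric_def by (simp add: finite_topspace_imp_discrete_topology compact_space_def finite_imp_compactin)
  then show "\<exists>X :: real metric. compact_metric X \<and> compact_metric X \<and> isometric X X"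
    using isometric_refl by blast
next
  show "symp (\<lambda>X Y :: real metric. compact_metric X \<and> compact_metric Y \<and> isometric X Y)"
    by (rule sympI) (simp add: isometric_sym)
  show "transp (\<lambda>X Y :: real metric. compact_metric X \<and> compact_metric Y \<and> isometric X Y)"
    by (rule transpI) (blast intro: isometric_trans)
qed

instantiation gh_space :: metric_space
begin

lift_definition dist_gh_space :: "gh_space \<Rightarrow> gh_space \<Rightarrow> real" is GH_dist
  using GH_dist_cong by blast

definition uniformity_gh_space :: "(gh_space \<times> gh_space) filter"
  where "uniformity_gh_space = (INF e\<in>{0<..}. principal {(x, y). dist x y < e})"

definition open_gh_space :: "gh_space set \<Rightarrow> bool"
  where "open_gh_space U \<longleftrightarrow> (\<forall>x\<in>U. \<forall>\<^sub>F (x', y) in uniformity. x' = x \<longrightarrow> y \<in> U)"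

instance
proof
  fix X Y Z :: gh_space
  show "dist X Y = 0 \<longleftrightarrow> X = Y"
    by transfer (use isometric_imp_GH_dist_0 GH_dist_0_imp_isometric in blast)
  show "dist X Y \<le> dist X Z + dist Y Z"
    by transfer (metis GH_dist_triangle GH_dist_commute)
qed (simp_all add: uniformity_gh_space_def open_gh_space_def)

end

lemma embeds_isometrically_cong:
  assumes "isometric X X'"
  shows "embeds_isometrically X Y \<longleftrightarrow> embeds_isometrically X' Y"
proof -
  have "embeds_isometrically X X'" "embeds_isometrically X' X"
    using assms isometric_imp_embeds isometric_sym by auto
  then show ?thesis
    using embeds_isometrically_trans[of X X' Y] embeds_isometrically_trans[of X' X Y] by auto
qed

lift_definition gh_embeds :: "gh_space \<Rightarrow> 'b metric \<Rightarrow> bool" is embeds_isometrically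
  by (auto simp: fun_eq_iff dest: embeds_isometrically_cong)

definition has_nonembeddable_quadruple :: "'a metric \<Rightarrow> bool"
  where "has_nonembeddable_quadruple X \<longleftrightarrow>
    (\<exists>F. F \<subseteq> mspace X \<and> card F = 4 \<and>
      \<not> embeds_isometrically (submetric X F) (euclidean_metric :: (real^3) metric))"

lemma has_nonembeddable_quadruple_isometric:
  assumes "isometric X Y" "has_nonembeddable_quadruple X"
  shows "has_nonembeddable_quadruple Y"
proof -
  obtain F where F: "F \<subseteq> mspace X" "card F = 4"
    "\<not> embeds_isometrically (submetric X F) (euclidean_metric :: (real^3) metric)"
    using assms(2) unfolding has_nonembeddable_quadruple_def by blast
  obtain f where f: "isometric_embedding X Y f"
    using assms(1) unfolding isometric_def by blast
  have "card (f ` F) = 4"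
    using isometric_embedding_inj[OF f] F by (metis card_image inj_on_subset)
  moreover have sub: "f ` F \<subseteq> mspace Y"
    using f F unfolding isometric_embedding_def by auto
  moreover have "isometric_embedding (submetric X F) (submetric Y (f ` F)) f"
    using f F sub unfolding isometric_embedding_def by (auto simp: subset_eq)
  then have "embeds_isometrically (submetric X F) (submetric Y (f ` F))"
    unfolding embeds_isometrically_def by blast
  then have "\<not> embeds_isometrically (submetric Y (f ` F)) (euclidean_metric :: (real^3) metric)"
    using F(3) embeds_isometrically_trans by metis
  ultimately show ?thesis
    unfolding has_nonembeddable_quadruple_def by blast
qed

lift_definition gh_has_nonembeddable_quadruple :: "gh_space \<Rightarrow> bool" is has_nonembeddable_quadruple
  using has_nonembeddable_quadruple_isometric isometric_sym by metis


section \<open>Baire category\<close>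

definition rare :: "'a :: topological_space set \<Rightarrow> bool"
  where "rare S \<longleftrightarrow> interior (closure S) = {}"

definition meager :: "'a :: topological_space set \<Rightarrow> bool"
  where "meager S \<longleftrightarrow> (\<exists>\<A>. countable \<A> \<and> (\<forall>A\<in>\<A>. rare A) \<and> S = \<Union>\<A>)"

definition residual :: "'a :: topological_space set \<Rightarrow> bool"
  where "residual S \<longleftrightarrow> meager (- S)"


section \<open>Hilbert spaces with an explicit carrier\<close>

text \<open>The type class of complete real inner product spaces does not allow quantifying over all Hilbert
  spaces inside a formula, so the structure is given on a carrier set. A complex Hilbert space is a
  real one under the real part of its inner product, with the same distance, so real scalars
  suffice for isometric embeddings of metric spaces.\<close>

locale pre_hilbert_space =
  fixes V :: "'h set" and add :: "'h \<Rightarrow> 'h \<Rightarrow> 'h" and zero :: 'h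
    and scl :: "real \<Rightarrow> 'h \<Rightarrow> 'h" and ip :: "'h \<Rightarrow> 'h \<Rightarrow> real"
  assumes add_closed: "x \<in> V \<Longrightarrow> y \<in> V \<Longrightarrow> add x y \<in> V"
    and zero_closed: "zero \<in> V"
    and scale_closed: "x \<in> V \<Longrightarrow> scl a x \<in> V"
    and add_assoc: "x \<in> V \<Longrightarrow> y \<in> V \<Longrightarrow> z \<in> V \<Longrightarrow> add (add x y) z = add x (add y z)"
    and add_comm: "x \<in> V \<Longrightarrow> y \<in> V \<Longrightarrow> add x y = add y x"
    and add_zero: "x \<in> V \<Longrightarrow> add x zero = x"
    and add_inverse: "x \<in> V \<Longrightarrow> add x (scl (-1) x) = zero"
    and scale_add_right: "x \<in> V \<Longrightarrow> y \<in> V \<Longrightarrow> scl a (add x y) = add (scl a x) (scl a y)"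
    and scale_add_left: "x \<in> V \<Longrightarrow> scl (a + b) x = add (scl a x) (scl b x)"
    and scale_scale: "x \<in> V \<Longrightarrow> scl a (scl b x) = scl (a * b) x"
    and scale_one: "x \<in> V \<Longrightarrow> scl 1 x = x"
    and ip_commute: "x \<in> V \<Longrightarrow> y \<in> V \<Longrightarrow> ip x y = ip y x"
    and ip_add_left: "x \<in> V \<Longrightarrow> y \<in> V \<Longrightarrow> z \<in> V \<Longrightarrow> ip (add x y) z = ip x z + ip y z"
    and ip_scale_left: "x \<in> V \<Longrightarrow> y \<in> V \<Longrightarrow> ip (scl a x) y = a * ip x y"
    and ip_nonneg: "x \<in> V \<Longrightarrow> 0 \<le> ip x x"
    and ip_eq_zero: "x \<in> V \<Longrightarrow> ip x x = 0 \<longleftrightarrow> x = zero"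

text \<open>The distance is \<open>\<parallel>x - y\<parallel>\<close>; the default value off the carrier is needed because the type
  of metrics asks for a nonnegative symmetric function on the whole type.\<close>

definition hilbert_dist :: "'h set \<Rightarrow> ('h \<Rightarrow> 'h \<Rightarrow> 'h) \<Rightarrow> (real \<Rightarrow> 'h \<Rightarrow> 'h) \<Rightarrow> ('h \<Rightarrow> 'h \<Rightarrow> real) \<Rightarrow>
    'h \<Rightarrow> 'h \<Rightarrow> real"
  where "hilbert_dist V add scl ip x y =
    (if x \<in> V \<and> y \<in> V
     then sqrt (ip (add x (scl (-1) y)) (add x (scl (-1) y)))
     else 0)"

definition hilbert_metric :: "'h set \<Rightarrow> ('h \<Rightarrow> 'h \<Rightarrow> 'h) \<Rightarrow> (real \<Rightarrow> 'h \<Rightarrow> 'h) \<Rightarrow> ('h \<Rightarrow> 'h \<Rightarrow> real) \<Rightarrow>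
    'h metric"
  where "hilbert_metric V add scl ip = metric (V, hilbert_dist V add scl ip)"

locale hilbert_space = pre_hilbert_space +
  assumes complete: "mcomplete_of (hilbert_metric V add scl ip)"

context pre_hilbert_space
begin

abbreviation sub :: "'h \<Rightarrow> 'h \<Rightarrow> 'h" where "sub x y \<equiv> add x (scl (-1) y)"

lemmas closed = add_closed zero_closed scale_closed

lemma sub_closed: "x \<in> V \<Longrightarrow> y \<in> V \<Longrightarrow> sub x y \<in> V"
  by (simp add: closed)

lemma ip_add_right: "x \<in> V \<Longrightarrow> y \<in> V \<Longrightarrow> z \<in> V \<Longrightarrow> ip z (add x y) = ip z x + ip z y"
  using ip_add_left[of x y z] ip_commute[of "add x y" z] ip_commute[of x z] ip_commute[of y z]
  by (simp add: add_closed)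

lemma ip_scale_right: "x \<in> V \<Longrightarrow> y \<in> V \<Longrightarrow> ip x (scl a y) = a * ip x y"
  using ip_scale_left[of y x a] ip_commute[of "scl a y" x] ip_commute[of x y]
  by (simp add: scale_closed)

lemma ip_zero: "x \<in> V \<Longrightarrow> ip zero x = 0"
  using ip_add_left[of zero zero x] add_zero zero_closed by simp

lemma cauchy_schwarz:
  assumes x: "x \<in> V" and y: "y \<in> V"
  shows "(ip x y)\<^sup>2 \<le> ip x x * ip y y"
proof (cases "ip y y = 0")
  case True
  then have "y = zero" using ip_eq_zero y by blast
  then show ?thesis using ip_zero x y ip_commute[OF x y] True by simp
next
  case False
  then have pos: "ip y y > 0" using ip_nonneg[OF y] by simp
  define t where "t = - ip x y / ip y y"
  have "ip (add x (scl t y)) (add x (scl t y)) = ip x x + 2 * t * ip x y + t\<^sup>2 * ip y y"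
    using x y ip_commute[OF y x]
    by (simp add: ip_add_left ip_add_right ip_scale_left ip_scale_right closed power2_eq_square algebra_simps)
  then have "0 \<le> ip x x + 2 * t * ip x y + t\<^sup>2 * ip y y"
    using ip_nonneg[of "add x (scl t y)"] x y closed by simp
  also have "\<dots> = ip x x - (ip x y)\<^sup>2 / ip y y"
    using pos by (simp add: t_def field_simps power2_eq_square)
  finally show ?thesis using pos by (simp add: field_simps)
qed

lemma norm_triangle:
  assumes x: "x \<in> V" and y: "y \<in> V"
  shows "sqrt (ip (add x y) (add x y)) \<le> sqrt (ip x x) + sqrt (ip y y)"
proof (rule real_le_lsqrt)
  have "ip x y \<le> sqrt (ip x x) * sqrt (ip y y)"
    using real_le_rsqrt[OF cauchy_schwarz[OF x y]] by (simp add: real_sqrt_mult)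
  then have "ip x x + 2 * ip x y + ip y y \<le> (sqrt (ip x x) + sqrt (ip y y))\<^sup>2"
    using ip_nonneg[OF x] ip_nonneg[OF y] by (simp add: power2_sum)
  then show "ip (add x y) (add x y) \<le> (sqrt (ip x x) + sqrt (ip y y))\<^sup>2"
    using x y ip_commute[OF y x] by (simp add: ip_add_left ip_add_right closed)
qed (use assms ip_nonneg in auto)

lemma add_left_comm:
  assumes "x \<in> V" "y \<in> V" "z \<in> V"
  shows "add x (add y z) = add y (add x z)"
  using add_assoc[OF assms] add_assoc[OF assms(2,1,3)] add_comm[OF assms(1,2)] by simp

lemma sub_trans:
  assumes "x \<in> V" "y \<in> V" "z \<in> V"
  shows "sub x z = add (sub x y) (sub y z)"
proof -
  have "add (sub x y) (sub y z) = add x (add (add y (scl (-1) y)) (scl (-1) z))"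
    using assms add_left_comm[of "scl (-1) y" y "scl (-1) z"] by (simp add: add_assoc closed)
  also have "\<dots> = sub x z"
    using assms add_comm[OF zero_closed] by (simp add: add_inverse add_zero closed)
  finally show ?thesis by simp
qed

lemma sub_eq_zero:
  assumes "x \<in> V" "y \<in> V"
  shows "sub x y = zero \<longleftrightarrow> x = y"
proof
  assume *: "sub x y = zero"
  have "x = add (sub x y) y"
    using assms add_comm[of "scl (-1) y" y] by (simp add: add_assoc add_inverse add_zero closed)
  then show "x = y" using * assms add_comm add_zero zero_closed by metis
qed (use assms add_inverse in auto)

lemma sub_swap:
  assumes "x \<in> V" "y \<in> V"
  shows "ip (sub x y) (sub x y) = ip (sub y x) (sub y x)"
  using assms ip_commute[OF assms]
  by (simp add: ip_add_left ip_add_right ip_scale_left ip_scale_right closed)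

lemma Metric_space_hilbert: "Metric_space V (hilbert_dist V add scl ip)"
proof
  show "0 \<le> hilbert_dist V add scl ip x y" for x y
    by (simp add: hilbert_dist_def ip_nonneg closed)
  show "hilbert_dist V add scl ip x y = hilbert_dist V add scl ip y x" for x y
    using sub_swap by (simp add: hilbert_dist_def)
  show "hilbert_dist V add scl ip x y = 0 \<longleftrightarrow> x = y" if "x \<in> V" "y \<in> V" for x y
    using that sub_eq_zero by (simp add: hilbert_dist_def ip_eq_zero closed)
  show "hilbert_dist V add scl ip x z \<le> hilbert_dist V add scl ip x y + hilbert_dist V add scl ip y z"
    if "x \<in> V" "y \<in> V" "z \<in> V" for x y z
    using that norm_triangle[of "sub x y" "sub y z"] sub_trans[OF that]
    by (simp add: hilbert_dist_def closed)
qed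

lemma mspace_hilbert_metric: "mspace (hilbert_metric V add scl ip) = V"
  and mdist_hilbert_metric: "mdist (hilbert_metric V add scl ip) = hilbert_dist V add scl ip"
proof -
  interpret Metric_space V "hilbert_dist V add scl ip" by (rule Metric_space_hilbert)
  show "mspace (hilbert_metric V add scl ip) = V"
    "mdist (hilbert_metric V add scl ip) = hilbert_dist V add scl ip"
    by (simp_all add: hilbert_metric_def)
qed

end

lemma hilbert_metric_UNIV:
  "hilbert_metric (UNIV :: 'h :: real_inner set) (+) scaleR inner = euclidean_metric"
proof -
  have "hilbert_dist (UNIV :: 'h set) (+) scaleR inner = dist"
    by (intro ext) (simp add: hilbert_dist_def dist_norm norm_eq_sqrt_inner)
  then show ?thesis by (simp add: hilbert_metric_def euclidean_metric_def)
qed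

theorem hilbert_space_class:
  "hilbert_space (UNIV :: 'h :: {real_inner, complete_space} set) (+) 0 scaleR inner"
proof (intro hilbert_space.intro hilbert_space_axioms.intro)
  show "pre_hilbert_space (UNIV :: 'h set) (+) 0 scaleR inner"
    by standard (auto simp: algebra_simps inner_commute inner_add_left)
  show "mcomplete_of (hilbert_metric (UNIV :: 'h set) (+) scaleR inner)"
    unfolding hilbert_metric_UNIV mcomplete_of_def
    by (simp add: complete_def Cauchy_convergent_iff convergent_def)
qed


text \<open>A compact metric space that embeds in any Hilbert space already embeds in one whose vectors are
  real numbers, namely a copy of the closed linear span of its image.\<close>

lemma mcomplete_closed_image:
  fixes X :: "'a metric" and Y :: "'b metric"
  assumes k: "isometric_embedding Y X k" and X: "mcomplete_of X"
    and closed: "\<And>x. x \<in> mspace X \<Longrightarrow> (\<And>e. e > 0 \<Longrightarrow> \<exists>y\<in>mspace Y. mdist X (k y) x < e) \<Longrightarrow>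
      x \<in> k ` mspace Y"
  shows "mcomplete_of Y"
proof -
  interpret X: Metric_space "mspace X" "mdist X" by simp
  interpret Y: Metric_space "mspace Y" "mdist Y" by simp
  have ki: "k y \<in> mspace X" if "y \<in> mspace Y" for y
    using k that unfolding isometric_embedding_def by auto
  have kd: "mdist X (k y) (k y') = mdist Y y y'" if "y \<in> mspace Y" "y' \<in> mspace Y" for y y'
    using k that unfolding isometric_embedding_def by auto
  show ?thesis
    unfolding mcomplete_of_def Y.mcomplete_def
  proof (intro allI impI)
    fix \<sigma> assume \<sigma>: "Y.MCauchy \<sigma>"
    then have sY: "\<sigma> n \<in> mspace Y" for n unfolding Y.MCauchy_def by auto
    have "X.MCauchy (k \<circ> \<sigma>)"
      using \<sigma> ki kd[OF sY sY] unfolding X.MCauchy_def Y.MCauchy_def by auto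
    then obtain x where "limitin X.mtopology (k \<circ> \<sigma>) x sequentially"
      using X unfolding mcomplete_of_def X.mcomplete_def by blast
    then have x: "x \<in> mspace X" and lim: "\<And>e. e > 0 \<Longrightarrow> \<exists>N. \<forall>n\<ge>N. mdist X (k (\<sigma> n)) x < e"
      unfolding X.limit_metric_sequentially o_def by (auto, meson)
    have "x \<in> k ` mspace Y"
      by (rule closed[OF x]) (use lim sY in blast)
    then obtain y where y: "y \<in> mspace Y" "x = k y" by blast
    have "limitin Y.mtopology \<sigma> y sequentially"
      unfolding Y.limit_metric_sequentially using y lim sY kd[OF sY y(1)] by auto
    then show "\<exists>y. limitin Y.mtopology \<sigma> y sequentially" by blast
  qed
qed

context pre_hilbert_space
begin

abbreviation dst :: "'h \<Rightarrow> 'h \<Rightarrow> real" where "dst \<equiv> hilbert_dist V add scl ip"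

abbreviation nrm :: "'h \<Rightarrow> real" where "nrm x \<equiv> sqrt (ip x x)"

lemma dst_eq: "x \<in> V \<Longrightarrow> y \<in> V \<Longrightarrow> dst x y = nrm (sub x y)"
  by (simp add: hilbert_dist_def)

lemma dst_add:
  assumes "x \<in> V" "y \<in> V" "x' \<in> V" "y' \<in> V"
  shows "dst (add x y) (add x' y') \<le> dst x x' + dst y y'"
proof -
  have "sub (add x y) (add x' y') = add (sub x x') (sub y y')"
    using assms add_left_comm[of y "scl (-1) x'" "scl (-1) y'"]
    by (simp add: add_assoc scale_add_right closed)
  then show ?thesis
    using norm_triangle[of "sub x x'" "sub y y'"] assms by (simp add: dst_eq closed)
qed

lemma dst_scale:
  assumes "x \<in> V" "y \<in> V"
  shows "dst (scl a x) (scl b y) \<le> \<bar>a\<bar> * dst x y + \<bar>a - b\<bar> * nrm y"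
proof -
  have nrm_scale: "nrm (scl c z) = \<bar>c\<bar> * nrm z" if "z \<in> V" for c z
    using that by (simp add: ip_scale_left ip_scale_right closed real_sqrt_mult)
  have "dst (scl a x) (scl b y) \<le> dst (scl a x) (scl a y) + dst (scl a y) (scl b y)"
    using assms by (intro Metric_space.triangle[OF Metric_space_hilbert]) (simp_all add: closed)
  moreover have "sub (scl a x) (scl a y) = scl a (sub x y)"
    using assms by (simp add: scale_add_right scale_scale closed)
  then have "dst (scl a x) (scl a y) = \<bar>a\<bar> * dst x y"
    using assms nrm_scale[of "sub x y" a] by (simp add: dst_eq closed)
  moreover have "sub (scl a y) (scl b y) = scl (a - b) y"
    using assms scale_add_left[of y a "- b"] by (simp add: scale_scale)
  then have "dst (scl a y) (scl b y) = \<bar>a - b\<bar> * nrm y"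
    using assms nrm_scale[of y "a - b"] by (simp add: dst_eq closed)
  ultimately show ?thesis by simp
qed

lemma subspace_transport:
  fixes h :: "'h \<Rightarrow> 'k"
  assumes W: "W \<subseteq> V" and inj: "inj_on h W"
    and Wadd: "\<And>x y. x \<in> W \<Longrightarrow> y \<in> W \<Longrightarrow> add x y \<in> W" and W0: "zero \<in> W"
    and Wscl: "\<And>a x. x \<in> W \<Longrightarrow> scl a x \<in> W"
  defines "k \<equiv> inv_into W h"
  defines "V' \<equiv> h ` W" and "add' \<equiv> \<lambda>u v. h (add (k u) (k v))"
    and "scl' \<equiv> \<lambda>a u. h (scl a (k u))" and "ip' \<equiv> \<lambda>u v. ip (k u) (k v)"
  shows "pre_hilbert_space V' add' (h zero) scl' ip'"
    and "isometric_embedding (hilbert_metric V' add' scl' ip') (hilbert_metric V add scl ip) k"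
proof -
  have kh: "k (h x) = x" if "x \<in> W" for x using inj that by (simp add: k_def)
  have WV: "x \<in> V" if "x \<in> W" for x using W that by blast
  show pre: "pre_hilbert_space V' add' (h zero) scl' ip'"
  proof
    show "add' x (scl' (- 1) x) = h zero" if "x \<in> V'" for x
      using that by (auto simp: V'_def add'_def scl'_def kh Wscl add_inverse WV)
    show "add' (add' x y) z = add' x (add' y z)" if "x \<in> V'" "y \<in> V'" "z \<in> V'" for x y z
      using that by (auto simp: V'_def add'_def kh Wadd add_assoc WV)
    show "add' x y = add' y x" if "x \<in> V'" "y \<in> V'" for x y
      using that by (auto simp: V'_def add'_def kh) (metis add_comm WV)
    show "ip' x y = ip' y x" if "x \<in> V'" "y \<in> V'" for x y
      using that by (auto simp: V'_def ip'_def kh ip_commute WV)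
    show "ip' x x = 0 \<longleftrightarrow> x = h zero" if "x \<in> V'" for x
      using that inj W0 by (auto simp: V'_def ip'_def kh ip_eq_zero WV inj_on_def)
  qed (auto simp: V'_def add'_def scl'_def ip'_def kh Wadd W0 Wscl WV add_zero scale_add_right
        scale_add_left scale_scale scale_one ip_add_left ip_scale_left ip_nonneg)
  show "isometric_embedding (hilbert_metric V' add' scl' ip') (hilbert_metric V add scl ip) k"
    unfolding isometric_embedding_def mspace_hilbert_metric mdist_hilbert_metric
      pre_hilbert_space.mspace_hilbert_metric[OF pre] pre_hilbert_space.mdist_hilbert_metric[OF pre]
  proof (intro conjI ballI)
    show "k \<in> V' \<rightarrow> V" by (auto simp: V'_def kh WV)
    fix u v assume "u \<in> V'" "v \<in> V'"
    then show "dst (k u) (k v) = hilbert_dist V' add' scl' ip' u v"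
      by (auto simp: hilbert_dist_def V'_def add'_def scl'_def ip'_def kh WV Wadd Wscl)
  qed
qed

end

theorem embeds_in_real_hilbert_space:
  fixes V :: "'h set" and X :: "'a metric"
  assumes H: "hilbert_space V add zero scl ip" and X: "compact_metric X"
    and emb: "embeds_isometrically X (hilbert_metric V add scl ip)"
  shows "\<exists>(V' :: real set) add' zero' scl' ip'. hilbert_space V' add' zero' scl' ip' \<and>
    embeds_isometrically X (hilbert_metric V' add' scl' ip')"
proof -
  interpret hilbert_space V add zero scl ip by (rule H)
  interpret M: Metric_space V dst by (rule Metric_space_hilbert)
  obtain f where f: "isometric_embedding X (hilbert_metric V add scl ip) f"
    using emb unfolding embeds_isometrically_def by blast
  then have fV: "f ` mspace X \<subseteq> V" and fd: "\<And>x x'. x \<in> mspace X \<Longrightarrow> x' \<in> mspace X \<Longrightarrow> dst (f x) (f x') = mdist X x x'"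
    unfolding isometric_embedding_def mspace_hilbert_metric mdist_hilbert_metric by auto
  obtain C where C: "countable C" "C \<subseteq> mspace X"
    "\<forall>x\<in>mspace X. \<forall>e>0. \<exists>c\<in>C. mdist X x c < e"
    using compact_metric_dense[OF X] by auto
  define comb :: "(rat \<times> 'h) list \<Rightarrow> 'h" where
    "comb l = foldr (\<lambda>(q, c) s. add (scl (real_of_rat q) c) s) l zero" for l
  define L where "L = lists ((UNIV :: rat set) \<times> f ` C)"
  have fC: "c \<in> V" if "c \<in> f ` C" for c using that fV C(2) by blast
  have comb_V: "comb l \<in> V" if "l \<in> L" for l
    using that unfolding L_def comb_def by (induction l) (auto simp: closed fC)
  have comb_append: "comb (l @ m) = add (comb l) (comb m)" if "l \<in> L" "m \<in> L" for l m
    using that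
  proof (induction l)
    case Nil
    then show ?case using comb_V[of m] add_comm[of zero] add_zero zero_closed by (simp add: comb_def)
  next
    case (Cons p l)
    obtain q c where p: "p = (q, c)" by fastforce
    have l: "l \<in> L" and c: "c \<in> V" using Cons.prems p fC by (auto simp: L_def)
    have "comb (p # l) = add (scl (real_of_rat q) c) (comb l)" for l
      by (simp add: comb_def p)
    then show ?case
      using Cons.IH[OF l Cons.prems(2)] l c comb_V Cons.prems(2) by (simp add: add_assoc closed)
  qed
  have comb_scale: "\<exists>m\<in>L. comb m = scl (real_of_rat q) (comb l)" if "l \<in> L" for l q
    using that
  proof (induction l)
    case Nil
    have "scl (real_of_rat q) zero = zero"
      using ip_eq_zero[of "scl (real_of_rat q) zero"] ip_zero[OF zero_closed] zero_closed
      by (simp add: ip_scale_left ip_scale_right closed)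
    then show ?case by (intro bexI[of _ "[]"]) (auto simp: comb_def L_def)
  next
    case (Cons p l)
    obtain r c where p: "p = (r, c)" by fastforce
    have l: "l \<in> L" and c: "c \<in> f ` C" "c \<in> V" using Cons.prems p fC by (auto simp: L_def)
    obtain m where m: "m \<in> L" "comb m = scl (real_of_rat q) (comb l)" using Cons.IH[OF l] by blast
    have "comb ((q * r, c) # m) = scl (real_of_rat q) (comb (p # l))"
      using m l c comb_V[OF l] unfolding comb_def
      by (simp add: p scale_add_right scale_scale closed of_rat_mult)
    moreover have "(q * r, c) # m \<in> L" using m(1) c(1) by (auto simp: L_def)
    ultimately show ?case by blast
  qed
  define S where "S = comb ` L"
  have S: "countable S" "S \<subseteq> V"
    using C(1) comb_V unfolding S_def L_def by (auto intro!: countable_image countable_lists countable_SIGMA)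
  define W where "W = {w \<in> V. \<forall>e>0. \<exists>s\<in>S. dst w s < e}"
  have WV: "W \<subseteq> V" by (auto simp: W_def)
  have SW: "S \<subseteq> W"
    using S(2) M.mdist_zero by (force simp: W_def)
  have W0: "zero \<in> W"
  proof -
    have "comb [] = zero" "[] \<in> L" by (auto simp: comb_def L_def)
    then show ?thesis using SW by (force simp: S_def)
  qed
  have Wadd: "add x y \<in> W" if x: "x \<in> W" and y: "y \<in> W" for x y
    unfolding W_def
  proof (intro CollectI conjI allI impI)
    show "add x y \<in> V" using x y by (simp add: W_def closed)
    fix e :: real assume "e > 0"
    then have "e/2 > 0" by simp
    then obtain s t where s: "s \<in> S" "dst x s < e/2" and t: "t \<in> S" "dst y t < e/2"
      using x y unfolding W_def by blast
    obtain l m where lm: "l \<in> L" "s = comb l" "m \<in> L" "t = comb m"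
      using s(1) t(1) unfolding S_def by blast
    have "l @ m \<in> L" using lm unfolding L_def by auto
    then have "add s t \<in> S"
      unfolding S_def using comb_append[OF lm(1,3)] lm by force
    moreover have "x \<in> V" "y \<in> V" "s \<in> V" "t \<in> V"
      using x y s(1) t(1) S(2) WV by blast+
    then have "dst (add x y) (add s t) < e"
      using dst_add[of x y s t] s(2) t(2) by linarith
    ultimately show "\<exists>s\<in>S. dst (add x y) s < e" by blast
  qed
  have Wscl: "scl a x \<in> W" if x: "x \<in> W" for a x
    unfolding W_def
  proof (intro CollectI conjI allI impI)
    show "scl a x \<in> V" using x by (simp add: W_def closed)
    fix e :: real assume e: "e > 0"
    then have "e / (2 * (\<bar>a\<bar> + 1)) > 0" by simp
    then obtain s where s: "s \<in> S" "dst x s < e / (2 * (\<bar>a\<bar> + 1))"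
      using x unfolding W_def by blast
    have sV: "s \<in> V" using s S by blast
    have "a < a + e / (2 * (nrm s + 1))" using e ip_nonneg[OF sV] by (simp add: add_nonneg_pos)
    then obtain q where q: "a < real_of_rat q" "real_of_rat q < a + e / (2 * (nrm s + 1))"
      using of_rat_dense by blast
    have "\<bar>a\<bar> * dst x s \<le> (\<bar>a\<bar> + 1) * dst x s" by (simp add: mult_right_mono)
    also have "\<dots> < e / 2" using s(2) by (simp add: field_simps)
    finally have 1: "\<bar>a\<bar> * dst x s < e / 2" .
    have n0: "nrm s \<ge> 0" using ip_nonneg[OF sV] by simp
    have "\<bar>a - real_of_rat q\<bar> * nrm s \<le> (e / (2 * (nrm s + 1))) * (nrm s + 1)"
      using q n0 by (intro mult_mono) auto
    also have "\<dots> = e / 2"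
    proof -
      have "e / (2 * (m + 1)) * (m + 1) = e / 2" if "m \<ge> 0" for m :: real
        using that by (simp add: field_simps)
      then show ?thesis using n0 by blast
    qed
    finally have 2: "\<bar>a - real_of_rat q\<bar> * nrm s \<le> e / 2" .
    have "dst (scl a x) (scl (real_of_rat q) s) < e"
      using dst_scale[of x s a "real_of_rat q"] 1 2 x sV WV by fastforce
    moreover have "scl (real_of_rat q) s \<in> S"
    proof -
      obtain l where l: "l \<in> L" "s = comb l" using s(1) unfolding S_def by blast
      then obtain m where "m \<in> L" "comb m = scl (real_of_rat q) s" using comb_scale[of l q] by blast
      then show ?thesis unfolding S_def by force
    qed
    ultimately show "\<exists>s\<in>S. dst (scl a x) s < e" by blast
  qed
  have fW: "f x \<in> W" if x: "x \<in> mspace X" for x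
    unfolding W_def
  proof (intro CollectI conjI allI impI)
    show "f x \<in> V" using fV x by blast
    fix e :: real assume "e > 0"
    then obtain c where c: "c \<in> C" "mdist X x c < e" using C(3) x by blast
    have "comb [(1, f c)] = f c" "[(1, f c)] \<in> L"
      using c(1) fC[of "f c"] by (simp_all add: comb_def L_def scale_one add_zero)
    then have "f c \<in> S" unfolding S_def by force
    moreover have "dst (f x) (f c) < e" using fd[OF x] c C(2) by auto
    ultimately show "\<exists>s\<in>S. dst (f x) s < e" by blast
  qed
  let ?W = "submetric (hilbert_metric V add scl ip) W"
  have mW: "mspace ?W = W" "mdist ?W = dst"
    using WV by (auto simp: mspace_hilbert_metric mdist_hilbert_metric)
  obtain h :: "'h \<Rightarrow> real" where h: "inj_on h W"
    by (rule separable_metric_inj_real[of S ?W]) (use S SW mW in \<open>auto simp: W_def\<close>)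
  note T = subspace_transport[OF WV h Wadd W0 Wscl]
  define k where "k = inv_into W h"
  define add' where "add' u v = h (add (k u) (k v))" for u v
  define scl' where "scl' a u = h (scl a (k u))" for a u
  define ip' where "ip' u v = ip (k u) (k v)" for u v
  have pre: "pre_hilbert_space (h ` W) add' (h zero) scl' ip'"
    using T(1) unfolding add'_def scl'_def ip'_def k_def .
  have iso: "isometric_embedding (hilbert_metric (h ` W) add' scl' ip') (hilbert_metric V add scl ip) k"
    using T(2) unfolding add'_def scl'_def ip'_def k_def .
  have kW: "k ` (h ` W) = W"
    using h by (force simp: k_def)
  note m' = pre_hilbert_space.mspace_hilbert_metric[OF pre] pre_hilbert_space.mdist_hilbert_metric[OF pre]
  have "mcomplete_of (hilbert_metric (h ` W) add' scl' ip')"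
  proof (rule mcomplete_closed_image[OF iso complete])
    fix x assume x: "x \<in> mspace (hilbert_metric V add scl ip)"
      and lim: "\<And>e. e > 0 \<Longrightarrow> \<exists>y\<in>mspace (hilbert_metric (h ` W) add' scl' ip').
        mdist (hilbert_metric V add scl ip) (k y) x < e"
    have xV: "x \<in> V" using x by (simp add: mspace_hilbert_metric)
    have lim': "\<exists>w\<in>W. dst w x < e" if "e > 0" for e
      using lim[OF that] kW unfolding m' mdist_hilbert_metric by blast
    have "x \<in> W"
      unfolding W_def
    proof (intro CollectI conjI allI impI xV)
      fix e :: real assume "e > 0"
      then have e2: "e/2 > 0" by simp
      obtain w where w: "w \<in> W" "dst w x < e/2" using lim'[OF e2] by blast
      obtain s where s: "s \<in> S" "dst w s < e/2" using w(1) e2 unfolding W_def by blast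
      have "dst x s \<le> dst w x + dst w s"
        using xV w s S WV by (intro M.triangle'') blast+
      then show "\<exists>s\<in>S. dst x s < e" using w s by force
    qed
    then show "x \<in> k ` mspace (hilbert_metric (h ` W) add' scl' ip')" by (simp add: m' kW)
  qed
  then have "hilbert_space (h ` W) add' (h zero) scl' ip'"
    using pre by (simp add: hilbert_space_def hilbert_space_axioms_def)
  moreover have "isometric_embedding X (hilbert_metric (h ` W) add' scl' ip') (h \<circ> f)"
    unfolding isometric_embedding_def m'
  proof (intro conjI ballI)
    show "h \<circ> f \<in> mspace X \<rightarrow> h ` W" using fW by auto
    fix x x' assume x: "x \<in> mspace X" "x' \<in> mspace X"
    have k: "k (h (f x)) = f x" "k (h (f x')) = f x'" using h fW x by (auto simp: k_def)
    have "h (f x) \<in> h ` W" "h (f x') \<in> h ` W" using fW x by blast+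
    then have "dst (k (h (f x))) (k (h (f x'))) = hilbert_dist (h ` W) add' scl' ip' (h (f x)) (h (f x'))"
      using iso unfolding isometric_embedding_def m' mdist_hilbert_metric by blast
    then show "hilbert_dist (h ` W) add' scl' ip' ((h \<circ> f) x) ((h \<circ> f) x') = mdist X x x'"
      using fd[OF x] unfolding k o_def by (rule trans[OF sym])
  qed
  ultimately show ?thesis unfolding embeds_isometrically_def by blast
qed


corollary gh_embeds_in_real_hilbert_space:
  fixes V :: "'h set"
  assumes "hilbert_space V add zero scl ip" "gh_embeds X (hilbert_metric V add scl ip)"
  shows "\<exists>(V' :: real set) add' zero' scl' ip'. hilbert_space V' add' zero' scl' ip' \<and>
    gh_embeds X (hilbert_metric V' add' scl' ip')"
  using assms(2)
proof (transfer fixing: V add scl ip)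
  fix X :: "real metric"
  assume "compact_metric X \<and> compact_metric X \<and> isometric X X"
    and "embeds_isometrically X (hilbert_metric V add scl ip)"
  then show "\<exists>(V' :: real set) add' zero' scl' ip'. hilbert_space V' add' zero' scl' ip' \<and>
    embeds_isometrically X (hilbert_metric V' add' scl' ip')"
    using embeds_in_real_hilbert_space[OF assms(1), of X] by blast
qed

end

theory Submission
  imports Defs
begin

text \<open>Both parts rest on the distance matrices of quadruples. Passing to a space close in the
  Gromov-Hausdorff distance changes distances by little, so the spaces all of whose distance matrices
  lie in a given closed set form a closed set; the distance matrices realised in \<open>\<real>\<^sup>3\<close> form such a closed
  set by compactness. For density, take the product of a space with a small tripod (three points at
  distance \<open>e\<close> from a centre and \<open>2 * e\<close> from each other). The tripod violates
  \<open>\<parallel>u - v\<parallel>\<^sup>2 + \<parallel>u - w\<parallel>\<^sup>2 + \<parallel>v - w\<parallel>\<^sup>2 \<le> 3 (\<parallel>u\<parallel>\<^sup>2 + \<parallel>v\<parallel>\<^sup>2 + \<parallel>w\<parallel>\<^sup>2)\<close>, whose two sides differ by \<open>\<parallel>u + v + w\<parallel>\<^sup>2\<close>.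
  As this inequality is a closed condition that holds in every Hilbert space, the spaces embeddable
  in a Hilbert space already form a rare set.\<close>

section \<open>Distance matrices under Gromov-Hausdorff convergence\<close>

definition distance_matrices :: "'a metric \<Rightarrow> (real^'n^'n) set"
  where "distance_matrices X = {\<chi> i j. mdist X (p i) (p j) | p. range p \<subseteq> mspace X}"

lemma distance_matrices_mono:
  assumes "embeds_isometrically X Y"
  shows "distance_matrices X \<subseteq> distance_matrices Y"
proof
  fix A :: "real^'n^'n" assume "A \<in> distance_matrices X"
  then obtain p where p: "range p \<subseteq> mspace X" "A = (\<chi> i j. mdist X (p i) (p j))"
    unfolding distance_matrices_def by blast
  obtain f where f: "isometric_embedding X Y f"
    using assms unfolding embeds_isometrically_def by blast
  have "range (f \<circ> p) \<subseteq> mspace Y"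
    using f p(1) unfolding isometric_embedding_def by auto
  moreover have "A = (\<chi> i j. mdist Y ((f \<circ> p) i) ((f \<circ> p) j))"
    using f p unfolding isometric_embedding_def by (simp add: range_subsetD)
  ultimately show "A \<in> distance_matrices Y"
    unfolding distance_matrices_def by blast
qed

lemma distance_matrices_isometric:
  assumes "isometric X Y"
  shows "distance_matrices X = distance_matrices Y"
  using distance_matrices_mono[OF isometric_imp_embeds[OF assms]]
    distance_matrices_mono[OF isometric_imp_embeds[OF isometric_sym[OF assms]]] by (rule equalityI)

lift_definition gh_distance_matrices :: "gh_space \<Rightarrow> (real^'n^'n) set" is distance_matrices
  using distance_matrices_isometric by blast

text \<open>Each \<open>p i\<close> has a partner \<open>q i\<close> with
  \<open>D (p i) (q i) \<le> r\<close>, and exchanging both endpoints alters a distance by at most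
  the two values of \<open>D\<close>. Distinct points may share a partner, which is why distance
  matrices are formed from families with repetitions.\<close>

lemma coupling_distance_matrix:
  assumes "coupling X Y r D" "A \<in> distance_matrices X"
  shows "\<exists>B\<in>distance_matrices Y. \<forall>i j. \<bar>B $ i $ j - A $ i $ j\<bar> \<le> 2 * r"
proof -
  note cD = couplingD[OF assms(1)]
  obtain p where p: "range p \<subseteq> mspace X" "A = (\<chi> i j. mdist X (p i) (p j))"
    using assms(2) unfolding distance_matrices_def by blast
  have pX: "p i \<in> mspace X" for i using p(1) by blast
  obtain q where q: "\<And>i. q i \<in> mspace Y" "\<And>i. D (p i) (q i) \<le> r"
    using cD(6)[OF pX] by metis
  have "\<bar>mdist Y (q i) (q j) - mdist X (p i) (p j)\<bar> \<le> 2 * r" for i j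
    using cD(2)[OF pX pX q(1), of i j j] cD(3)[OF pX pX q(1), of i j j]
      cD(4)[OF pX q(1) q(1), of i j i] cD(5)[OF pX q(1) q(1), of i j i]
      q(2)[of i] q(2)[of j] mdist_commute[of Y "q i" "q j"] by linarith
  moreover have "(\<chi> i j. mdist Y (q i) (q j)) \<in> distance_matrices Y"
    unfolding distance_matrices_def using q(1) by blast
  ultimately show ?thesis
    using p(2) by (intro bexI[of _ "\<chi> i j. mdist Y (q i) (q j)"]) simp_all
qed

lemma gh_distance_matrix_near:
  assumes "dist X Y < r" "A \<in> gh_distance_matrices X"
  shows "\<exists>B\<in>gh_distance_matrices Y. \<forall>i j. \<bar>B $ i $ j - A $ i $ j\<bar> \<le> 2 * r"
  using assms by transfer (use GH_dist_less_imp_coupling coupling_distance_matrix in blast)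

text \<open>Any matrix of a limit space is a limit of matrices of the approximating spaces, so it
  stays in a closed \<open>K\<close>.\<close>

lemma closed_gh_distance_matrices_subset:
  fixes K :: "(real^'n^'n) set"
  assumes "closed K"
  shows "closed {X. gh_distance_matrices X \<subseteq> K}"
  unfolding closed_sequential_limits
proof (intro allI impI, elim conjE)
  fix X l assume X: "\<forall>n. X n \<in> {X. gh_distance_matrices X \<subseteq> K}" and lim: "X \<longlonglongrightarrow> l"
  have "A \<in> K" if A: "A \<in> gh_distance_matrices l" for A
  proof -
    \<comment> \<open>The added term makes \<open>r n\<close> strictly larger than the distance, as
      \<open>gh_distance_matrix_near\<close> requires, and tends to 0.\<close>
    define r where "r n = dist l (X n) + inverse (real (Suc n))" for n
    have "\<exists>B\<in>gh_distance_matrices (X n). \<forall>i j. \<bar>B $ i $ j - A $ i $ j\<bar> \<le> 2 * r n" for n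
      by (rule gh_distance_matrix_near[OF _ A]) (simp add: r_def)
    then obtain B where B: "\<And>n. B n \<in> gh_distance_matrices (X n)"
      "\<And>n i j. \<bar>B n $ i $ j - A $ i $ j\<bar> \<le> 2 * r n"
      by metis
    have "(\<lambda>n. 2 * r n) \<longlonglongrightarrow> 2 * (dist l l + 0)"
      unfolding r_def by (intro tendsto_intros lim LIMSEQ_inverse_real_of_nat)
    then have "(\<lambda>n. 2 * r n) \<longlonglongrightarrow> 0" by simp
    then have "(\<lambda>n. B n $ i $ j - A $ i $ j) \<longlonglongrightarrow> 0" for i j
      by (rule Lim_null_comparison[rotated]) (use B(2) in simp)
    then have "B \<longlonglongrightarrow> A"
      by (intro vec_tendstoI) (simp add: Lim_null[symmetric])
    moreover have "\<forall>n. B n \<in> K" using B(1) X by blast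
    ultimately show ?thesis
      using assms unfolding closed_sequential_limits by blast
  qed
  then show "l \<in> {X. gh_distance_matrices X \<subseteq> K}" by blast
qed

section \<open>Quadruples in Euclidean space and openness\<close>

lemma closed_euclidean_distance_matrices:
  "closed (distance_matrices (euclidean_metric :: 'a::euclidean_space metric) :: (real^'n^'n) set)"
  unfolding closed_sequential_limits
proof (intro allI impI, elim conjE)
  fix A :: "nat \<Rightarrow> real^'n^'n" and L
  assume A: "\<forall>n. A n \<in> distance_matrices (euclidean_metric :: 'a metric)" and lim: "A \<longlonglongrightarrow> L"
  have limij: "(\<lambda>n. A n $ i $ j) \<longlonglongrightarrow> L $ i $ j" for i j
    by (intro tendsto_vec_nth lim)
  have "\<exists>p :: 'n \<Rightarrow> 'a. A n = (\<chi> i j. dist (p i) (p j))" for n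
    using A unfolding distance_matrices_def by auto
  then obtain p :: "nat \<Rightarrow> 'n \<Rightarrow> 'a" where p: "\<And>n i j. A n $ i $ j = dist (p n i) (p n j)"
    by (metis vec_lambda_beta)
  obtain k :: 'n where True by simp
  \<comment> \<open>Translating the point with index \<open>k\<close> to the origin makes the configurations bounded.\<close>
  define q :: "nat \<Rightarrow> 'a^'n" where "q n = (\<chi> i. p n i - p n k)" for n
  obtain C where C: "\<And>n. norm (A n) \<le> C"
    using convergent_imp_bounded[OF lim] unfolding bounded_iff by blast
  have "norm (q n) \<le> (\<Sum>i\<in>(UNIV :: 'n set). C)" for n
  proof -
    have "norm (q n $ i) \<le> C" for i
    proof -
      have "norm (q n $ i) = norm (A n $ i $ k)" by (simp add: q_def p dist_norm)
      also have "\<dots> \<le> norm (A n $ i)" by (rule Finite_Cartesian_Product.norm_nth_le)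
      also have "\<dots> \<le> norm (A n)" by (rule Finite_Cartesian_Product.norm_nth_le)
      finally show ?thesis using C[of n] by simp
    qed
    then show ?thesis
      unfolding norm_vec_def by (intro order_trans[OF L2_set_le_sum] sum_mono) simp_all
  qed
  then have "bounded (range q)" unfolding bounded_iff by blast
  \<comment> \<open>Bolzano-Weierstrass. As distances are continuous and translation invariant, the
    limit configuration \<open>l\<close> realises \<open>L\<close>.\<close>
  then obtain l r where r: "strict_mono r" and l: "(q \<circ> r) \<longlonglongrightarrow> l"
    using bounded_imp_convergent_subsequence by blast
  have "L $ i $ j = dist (l $ i) (l $ j)" for i j
  proof (rule LIMSEQ_unique)
    have "(\<lambda>n. dist ((q \<circ> r) n $ i) ((q \<circ> r) n $ j)) \<longlonglongrightarrow> dist (l $ i) (l $ j)"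
      by (intro tendsto_intros l)
    then show "(\<lambda>n. A (r n) $ i $ j) \<longlonglongrightarrow> dist (l $ i) (l $ j)"
      by (simp add: q_def p dist_norm)
    show "(\<lambda>n. A (r n) $ i $ j) \<longlonglongrightarrow> L $ i $ j"
      using LIMSEQ_subseq_LIMSEQ[OF limij r] by (simp add: o_def)
  qed
  then have "L = (\<chi> i j. mdist euclidean_metric (l $ i) (l $ j))"
    by (simp add: vec_eq_iff)
  then show "L \<in> distance_matrices (euclidean_metric :: 'a metric)"
    unfolding distance_matrices_def by auto
qed

text \<open>Once \<open>F\<close> is enumerated by \<open>p\<close>, an embedding of
  \<open>F\<close> amounts to a family in \<open>Y\<close> with the same mutual distances:
  \<open>q \<circ> inv p\<close> recovers the map from the family.\<close>

lemma embeds_iff_distance_matrix: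
  assumes bij: "bij_betw p UNIV F" and F: "F \<subseteq> mspace X"
  shows "embeds_isometrically (submetric X F) Y \<longleftrightarrow>
    (\<chi> i j. mdist X (p i) (p j)) \<in> distance_matrices Y"
proof
  have pF: "range p = F" using bij by (simp add: bij_betw_def)
  show "(\<chi> i j. mdist X (p i) (p j)) \<in> distance_matrices Y" if "embeds_isometrically (submetric X F) Y"
  proof -
    have "(\<chi> i j. mdist X (p i) (p j)) \<in> distance_matrices (submetric X F)"
      unfolding distance_matrices_def using pF F by auto
    then show ?thesis using distance_matrices_mono[OF that] by blast
  qed
  assume "(\<chi> i j. mdist X (p i) (p j)) \<in> distance_matrices Y"
  then obtain q where q: "range q \<subseteq> mspace Y" "\<And>i j. mdist X (p i) (p j) = mdist Y (q i) (q j)"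
    unfolding distance_matrices_def by (auto simp: vec_eq_iff)
  have "isometric_embedding (submetric X F) Y (q \<circ> inv p)"
    unfolding isometric_embedding_def using q(1) pF by (auto simp: q(2)[symmetric] f_inv_into_f)
  then show "embeds_isometrically (submetric X F) Y"
    unfolding embeds_isometrically_def by blast
qed

text \<open>Matrices with a zero entry off the diagonal discard the quadruples with repetitions.\<close>

lemma has_nonembeddable_quadruple_iff:
  "has_nonembeddable_quadruple X \<longleftrightarrow>
    \<not> distance_matrices X \<subseteq> distance_matrices (euclidean_metric :: (real^3) metric) \<union>
        {A :: real^4^4. \<exists>i j. i \<noteq> j \<and> A $ i $ j = 0}"
proof
  assume "has_nonembeddable_quadruple X"
  then obtain F where F: "F \<subseteq> mspace X" "card F = 4"
    and ne: "\<not> embeds_isometrically (submetric X F) (euclidean_metric :: (real^3) metric)"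
    unfolding has_nonembeddable_quadruple_def by blast
  have "finite F" using F(2) by (simp add: card_ge_0_finite)
  then obtain p :: "4 \<Rightarrow> 'a" where p: "bij_betw p UNIV F"
    using finite_same_card_bij[of "UNIV :: 4 set" F] F(2) by auto
  have pX: "p i \<in> mspace X" for i using p F(1) unfolding bij_betw_def by blast
  then have "(\<chi> i j. mdist X (p i) (p j)) \<in> distance_matrices X"
    unfolding distance_matrices_def by blast
  moreover have "p i \<noteq> p j" if "i \<noteq> j" for i j
    using p that unfolding bij_betw_def inj_on_def by blast
  then have "(\<chi> i j. mdist X (p i) (p j)) \<notin> {A :: real^4^4. \<exists>i j. i \<noteq> j \<and> A $ i $ j = 0}"
    using pX by auto
  ultimately show "\<not> distance_matrices X \<subseteq> distance_matrices (euclidean_metric :: (real^3) metric) \<union>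
        {A :: real^4^4. \<exists>i j. i \<noteq> j \<and> A $ i $ j = 0}"
    using ne embeds_iff_distance_matrix[OF p F(1)] by blast
next
  assume "\<not> distance_matrices X \<subseteq> distance_matrices (euclidean_metric :: (real^3) metric) \<union>
        {A :: real^4^4. \<exists>i j. i \<noteq> j \<and> A $ i $ j = 0}"
  then obtain A :: "real^4^4" where A: "A \<in> distance_matrices X"
    "A \<notin> distance_matrices (euclidean_metric :: (real^3) metric)" "\<And>i j. i \<noteq> j \<Longrightarrow> A $ i $ j \<noteq> 0"
    by blast
  obtain p where p: "range p \<subseteq> mspace X" "A = (\<chi> i j. mdist X (p i) (p j))"
    using A(1) unfolding distance_matrices_def by blast
  have "inj p"
  proof (rule injI, rule ccontr)
    fix i j assume "p i = p j" "i \<noteq> j"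
    then show False using A(3)[of i j] p by (auto simp: image_subset_iff)
  qed
  then have "bij_betw p UNIV (range p)" "card (range p) = 4"
    by (simp_all add: bij_betw_def card_image)
  then show "has_nonembeddable_quadruple X"
    unfolding has_nonembeddable_quadruple_def
    using p A(2) embeds_iff_distance_matrix[of p "range p" X] by blast
qed

lemma gh_has_nonembeddable_quadruple_iff:
  "gh_has_nonembeddable_quadruple X \<longleftrightarrow>
    \<not> gh_distance_matrices X \<subseteq> distance_matrices (euclidean_metric :: (real^3) metric) \<union>
        {A :: real^4^4. \<exists>i j. i \<noteq> j \<and> A $ i $ j = 0}"
  by transfer (rule has_nonembeddable_quadruple_iff)

text \<open>The complement is cut out by a closed set of matrices: those realised in Euclidean space
  together with finitely many coordinate hyperplanes.\<close>

lemma open_gh_has_nonembeddable_quadruple: "open {X. gh_has_nonembeddable_quadruple X}"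
proof -
  have "closed (\<Union>i. \<Union>j\<in>{j. i \<noteq> j}. {A :: real^4^4. A $ i $ j = 0})"
    by (intro closed_UN finite_class.finite ballI closed_Collect_eq continuous_intros)
  also have "(\<Union>i. \<Union>j\<in>{j. i \<noteq> j}. {A :: real^4^4. A $ i $ j = 0}) = {A. \<exists>i j. i \<noteq> j \<and> A $ i $ j = 0}"
    by blast
  finally have "closed {X. gh_distance_matrices X \<subseteq> distance_matrices (euclidean_metric :: (real^3) metric) \<union>
        {A :: real^4^4. \<exists>i j. i \<noteq> j \<and> A $ i $ j = 0}}"
    by (rule closed_gh_distance_matrices_subset[OF closed_Un[OF closed_euclidean_distance_matrices]])
  then show ?thesis
    unfolding closed_def gh_has_nonembeddable_quadruple_iff Collect_neg_eq .
qed

section \<open>The tripod inequality in Hilbert spaces\<close>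

definition tripod_inequality :: "(real^4^4) set"
  where "tripod_inequality = {A. (A $ 1 $ 2)\<^sup>2 + (A $ 1 $ 3)\<^sup>2 + (A $ 2 $ 3)\<^sup>2 \<le>
    3 * ((A $ 1 $ 4)\<^sup>2 + (A $ 2 $ 4)\<^sup>2 + (A $ 3 $ 4)\<^sup>2)}"

lemma closed_tripod_inequality: "closed tripod_inequality"
  unfolding tripod_inequality_def by (intro closed_Collect_le continuous_intros)

lemma (in pre_hilbert_space) distance_matrices_tripod_inequality:
  "distance_matrices (hilbert_metric V add scl ip) \<subseteq> tripod_inequality"
proof
  fix A :: "real^4^4" assume "A \<in> distance_matrices (hilbert_metric V add scl ip)"
  then obtain p where "range p \<subseteq> V" "A = (\<chi> i j. dst (p i) (p j))"
    unfolding distance_matrices_def mspace_hilbert_metric mdist_hilbert_metric by blast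
  then have pV: "p i \<in> V" and A: "A $ i $ j = dst (p i) (p j)" for i j
    by auto
  \<comment> \<open>With \<open>p 4\<close> as the centre, \<open>S\<close> is the vector u + v + w
    whose square is the difference of the two sides.\<close>
  define S where "S = add (add (sub (p 1) (p 4)) (sub (p 2) (p 4))) (sub (p 3) (p 4))"
  have SV: "S \<in> V" by (simp add: S_def closed pV)
  have sq: "(dst x y)\<^sup>2 = ip x x - 2 * ip x y + ip y y" if "x \<in> V" "y \<in> V" for x y
    using that ip_nonneg[of "sub x y"] ip_commute[of y x]
    by (simp add: dst_eq closed ip_add_left ip_add_right ip_scale_left ip_scale_right)
  have "ip S S = 3 * ((A $ 1 $ 4)\<^sup>2 + (A $ 2 $ 4)\<^sup>2 + (A $ 3 $ 4)\<^sup>2) -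
      ((A $ 1 $ 2)\<^sup>2 + (A $ 1 $ 3)\<^sup>2 + (A $ 2 $ 3)\<^sup>2)"
    \<comment> \<open>Expanding both sides leaves a linear identity in the products
      \<open>ip (p i) (p j)\<close>; these instances identify each mixed product with its mirror
      image.\<close>
    using ip_commute[OF pV pV, of 2 1] ip_commute[OF pV pV, of 3 1] ip_commute[OF pV pV, of 4 1]
      ip_commute[OF pV pV, of 3 2] ip_commute[OF pV pV, of 4 2] ip_commute[OF pV pV, of 4 3]
    by (simp only: S_def A sq pV closed ip_add_left ip_add_right ip_scale_left ip_scale_right)
      (simp add: algebra_simps)
  then show "A \<in> tripod_inequality"
    using ip_nonneg[OF SV] by (simp add: tripod_inequality_def)
qed

lemma gh_embeds_hilbert_tripod_inequality:
  assumes "hilbert_space V add zero scl ip" "gh_embeds X (hilbert_metric V add scl ip)"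
  shows "gh_distance_matrices X \<subseteq> tripod_inequality"
proof -
  interpret hilbert_space V add zero scl ip by (rule assms(1))
  have "gh_distance_matrices X \<subseteq> (distance_matrices (hilbert_metric V add scl ip) :: (real^4^4) set)"
    using assms(2) by transfer (rule distance_matrices_mono)
  then show ?thesis using distance_matrices_tripod_inequality by blast
qed

section \<open>Products with small tripods and density\<close>

definition tripod_dist :: "real \<Rightarrow> 4 \<Rightarrow> 4 \<Rightarrow> real"
  where "tripod_dist e i j = (if i = j then 0 else (if i = 4 then 0 else e) + (if j = 4 then 0 else e))"

definition tripod :: "real \<Rightarrow> 4 metric"
  where "tripod e = metric (UNIV, tripod_dist e)"

lemma tripod:
  assumes "e > 0"
  shows "mspace (tripod e) = UNIV" "mdist (tripod e) = tripod_dist e" "compact_metric (tripod e)"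
proof -
  interpret Metric_space UNIV "tripod_dist e"
    by unfold_locales (use assms in \<open>auto simp: tripod_dist_def\<close>)
  show "mspace (tripod e) = UNIV" "mdist (tripod e) = tripod_dist e"
    by (simp_all add: tripod_def)
  then show "compact_metric (tripod e)"
    by (simp add: compact_metric_def compact_space_def finite_imp_compactin)
qed

text \<open>The left side is 3 * (2 * e)^2 = 12 * e^2, the right side only 3 * 3 * e^2 = 9 *
  e^2.\<close>

lemma tripod_matrix_not_tripod_inequality:
  assumes "e > 0"
  shows "(\<chi> i j. tripod_dist e i j) \<notin> tripod_inequality"
proof -
  \<comment> \<open>Numerals of type \<open>4\<close> are read modulo 4, so \<open>4\<close> is the
    element 0 and \<open>1\<close> to \<open>4\<close> are all four elements.\<close>
  have "(1::4) \<noteq> 2" "(1::4) \<noteq> 3" "(2::4) \<noteq> 3" "(1::4) \<noteq> 4" "(2::4) \<noteq> 4" "(3::4) \<noteq> 4"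
    by simp_all
  then show ?thesis
    using assms by (simp add: tripod_inequality_def tripod_dist_def power2_eq_square)
qed

text \<open>The slice over \<open>c\<close> is a copy of \<open>X\<close> inside the product, and
  ambient distances to it form a coupling. A point \<open>(x, q)\<close> is within \<open>e\<close>
  of \<open>(x, c)\<close>, so only the radius of \<open>Q\<close> around \<open>c\<close>
  enters.\<close>

lemma coupling_prod_metric:
  assumes c: "c \<in> mspace Q" and e: "\<And>q. q \<in> mspace Q \<Longrightarrow> mdist Q c q \<le> e"
  shows "coupling X (prod_metric X Q) e (\<lambda>x. mdist (prod_metric X Q) (x, c))"
proof -
  let ?P = "prod_metric X Q"
  have emb: "mdist ?P (x, c) (x', c) = mdist X x x'" if "x \<in> mspace X" "x' \<in> mspace X" for x x'
    using mdist_zero[OF c c] unfolding mdist_prod_metric prod_dist_def by force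
  have inP: "(x, c) \<in> mspace ?P" if "x \<in> mspace X" for x
    using that c by simp
  have fib: "mdist ?P (x, c) (x, q) \<le> e" if "x \<in> mspace X" "q \<in> mspace Q" for x q
    using e[OF that(2)] mdist_zero[OF that(1,1)] unfolding mdist_prod_metric prod_dist_def by force
  show ?thesis
    unfolding coupling_def
  proof (intro conjI ballI)
    show "0 \<le> mdist ?P (x, c) y" for x y by (rule mdist_nonneg)
  next
    fix x x' y assume *: "x \<in> mspace X" "x' \<in> mspace X" "y \<in> mspace ?P"
    show "mdist X x x' \<le> mdist ?P (x, c) y + mdist ?P (x', c) y"
      using mdist_triangle[OF inP[OF *(1)] *(3) inP[OF *(2)]]
      unfolding emb[OF *(1,2)] mdist_commute[of _ y "(x', c)"] .
    show "mdist ?P (x, c) y \<le> mdist X x x' + mdist ?P (x', c) y"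
      using mdist_triangle[OF inP[OF *(1)] inP[OF *(2)] *(3)] unfolding emb[OF *(1,2)] .
  next
    fix x y y' assume *: "x \<in> mspace X" "y \<in> mspace ?P" "y' \<in> mspace ?P"
    show "mdist ?P y y' \<le> mdist ?P (x, c) y + mdist ?P (x, c) y'"
      using mdist_triangle[OF *(2) inP[OF *(1)] *(3)] unfolding mdist_commute[of _ y "(x, c)"] .
    show "mdist ?P (x, c) y \<le> mdist ?P (x, c) y' + mdist ?P y' y"
      by (rule mdist_triangle[OF inP[OF *(1)] *(3,2)])
  next
    show "\<exists>y\<in>mspace ?P. mdist ?P (x, c) y \<le> e" if "x \<in> mspace X" for x
      using inP[OF that] fib[OF that c] by blast
  next
    fix y assume "y \<in> mspace ?P"
    then show "\<exists>x\<in>mspace X. mdist ?P (x, c) y \<le> e"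
      using fib by (intro bexI[of _ "fst y"]) auto
  qed
qed

lemma compact_metric_prod:
  assumes "compact_metric X" "compact_metric Y"
  shows "compact_metric (prod_metric X Y)"
  using assms unfolding compact_metric_def
  by (simp add: mtopology_of_prod_metric compact_space_prod_topology)

lemma gh_tripod_near:
  assumes e: "e > 0"
  shows "\<exists>Y. dist X Y \<le> e \<and> (\<chi> i j. tripod_dist e i j) \<in> gh_distance_matrices Y"
proof (transfer fixing: e)
  fix X :: "real metric"
  assume "compact_metric X \<and> compact_metric X \<and> isometric X X"
  then have X: "compact_metric X" by blast
  let ?P = "prod_metric X (tripod e)"
  have P: "compact_metric ?P" by (rule compact_metric_prod[OF X tripod(3)[OF e]])
  \<comment> \<open>Elements of \<open>gh_space\<close> are represented by metrics on real numbers,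
    so the product is replaced by an isometric copy.\<close>
  then obtain Y :: "real metric" where Y: "compact_metric Y" "isometric ?P Y"
    using compact_metric_isometric_real by blast
  have "coupling X ?P e (\<lambda>x. mdist ?P (x, 4))"
    using e by (intro coupling_prod_metric) (simp_all add: tripod tripod_dist_def)
  \<comment> \<open>The product has points of type \<open>real \<times> 4\<close>, where
    \<open>GH_dist\<close> is not defined. Couplings exist over any types, so the bound reaches
    \<open>Y\<close> by composing them.\<close>
  moreover obtain E where "coupling ?P Y 0 E"
    using coupling_isometric[OF Y(2)] by blast
  ultimately obtain D where "coupling X Y (e + 0) D"
    using coupling_trans[of ?P X e _ Y 0 E] P unfolding compact_metric_def by blast
  then have "GH_dist X Y \<le> e"
    using coupling_imp_GH_dist_le[OF X Y(1)] by simp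
  moreover have "(\<chi> i j. tripod_dist e i j) \<in> distance_matrices ?P"
  proof -
    obtain x where x: "x \<in> mspace X" using X unfolding compact_metric_def by blast
    \<comment> \<open>The fibre over a single point \<open>x\<close> is an isometric copy of the
      tripod.\<close>
    have "(\<chi> i j. tripod_dist e i j) = (\<chi> i j. mdist ?P (x, i) (x, j))"
      using mdist_zero[OF x x] e mdist_nonneg[of "tripod e"]
      unfolding mdist_prod_metric prod_dist_def by (simp add: tripod[OF e] vec_eq_iff)
    moreover have "range (\<lambda>i. (x, i)) \<subseteq> mspace ?P"
      using x e by (auto simp: tripod)
    ultimately show ?thesis unfolding distance_matrices_def by blast
  qed
  ultimately show "\<exists>Y\<in>{Y. compact_metric Y \<and> compact_metric Y \<and> isometric Y Y}.
      GH_dist X Y \<le> e \<and> (\<chi> i j. tripod_dist e i j) \<in> distance_matrices Y"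
    using Y distance_matrices_isometric[OF Y(2)] isometric_refl by blast
qed

lemma closure_gh_tripod:
  "closure {X. \<exists>e>0. (\<chi> i j. tripod_dist e i j) \<in> gh_distance_matrices X} = UNIV"
proof -
  have "\<exists>Y\<in>{X. \<exists>e>0. (\<chi> i j. tripod_dist e i j) \<in> gh_distance_matrices X}. dist Y X < r"
    if "r > 0" for X r
  proof -
    \<comment> \<open>Halving turns the non-strict bound of \<open>gh_tripod_near\<close> into a
      strict one.\<close>
    have r: "r / 2 > 0" using that by simp
    then obtain Y where Y: "dist X Y \<le> r / 2" "(\<chi> i j. tripod_dist (r / 2) i j) \<in> gh_distance_matrices Y"
      using gh_tripod_near by blast
    have "dist Y X < r" using Y(1) that by (simp add: dist_commute)
    then show ?thesis using Y(2) r by blast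
  qed
  then show ?thesis
    unfolding set_eq_iff closure_approachable by blast
qed

text \<open>Three-dimensional Euclidean space is a Hilbert space, so its matrices satisfy the
  inequality that the tripod violates. The tripod matrix vanishes only on the diagonal, hence comes
  from four distinct points.\<close>

lemma gh_tripod_has_nonembeddable_quadruple:
  assumes e: "e > 0" and X: "(\<chi> i j. tripod_dist e i j) \<in> gh_distance_matrices X"
  shows "gh_has_nonembeddable_quadruple X"
proof -
  have "distance_matrices (euclidean_metric :: (real^3) metric) \<subseteq> tripod_inequality"
    using pre_hilbert_space.distance_matrices_tripod_inequality[OF hilbert_space.axioms(1)[OF
      hilbert_space_class[where 'h = "real^3"]]] unfolding hilbert_metric_UNIV .
  then have "(\<chi> i j. tripod_dist e i j) \<notin> distance_matrices (euclidean_metric :: (real^3) metric)"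
    using tripod_matrix_not_tripod_inequality[OF e] by blast
  moreover have "tripod_dist e i j \<noteq> 0" if "i \<noteq> j" for i j
    using that e by (auto simp: tripod_dist_def)
  then have "(\<chi> i j. tripod_dist e i j) \<notin> {A :: real^4^4. \<exists>i j. i \<noteq> j \<and> A $ i $ j = 0}"
    by auto
  ultimately show ?thesis
    unfolding gh_has_nonembeddable_quadruple_iff using X by blast
qed

text \<open>The set is closed and its complement contains the dense set of spaces with a tripod, so
  its interior is empty.\<close>

lemma rare_gh_tripod_inequality:
  "rare {X. gh_distance_matrices X \<subseteq> tripod_inequality}"
proof -
  have "closed {X. gh_distance_matrices X \<subseteq> tripod_inequality}"
    by (rule closed_gh_distance_matrices_subset[OF closed_tripod_inequality])
  moreover have "{X. \<exists>e>0. (\<chi> i j. tripod_dist e i j) \<in> gh_distance_matrices X} \<subseteq>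
      - {X. gh_distance_matrices X \<subseteq> tripod_inequality}"
    using tripod_matrix_not_tripod_inequality by blast
  then have "closure (- {X. gh_distance_matrices X \<subseteq> tripod_inequality}) = UNIV"
    using closure_gh_tripod closure_mono by blast
  ultimately show ?thesis
    unfolding rare_def by (simp add: interior_closure)
qed

lemma rare_subset: "rare T \<Longrightarrow> S \<subseteq> T \<Longrightarrow> rare S"
  unfolding rare_def using interior_mono closure_mono by blast

theorem theorem6:
  shows "open {X :: gh_space. gh_has_nonembeddable_quadruple X} \<and>
    closure {X :: gh_space. gh_has_nonembeddable_quadruple X} = UNIV \<and>
    residual {X :: gh_space. \<not> (\<exists>(V :: 'h set) add zero scl ip.
      hilbert_space V add zero scl ip \<and> gh_embeds X (hilbert_metric V add scl ip))}"
proof (intro conjI)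
  show "open {X. gh_has_nonembeddable_quadruple X}"
    by (rule open_gh_has_nonembeddable_quadruple)
  have "{X. \<exists>e>0. (\<chi> i j. tripod_dist e i j) \<in> gh_distance_matrices X} \<subseteq>
      {X. gh_has_nonembeddable_quadruple X}"
    using gh_tripod_has_nonembeddable_quadruple by blast
  then show "closure {X. gh_has_nonembeddable_quadruple X} = UNIV"
    using closure_gh_tripod closure_mono by blast
  let ?H = "{X. \<exists>(V :: 'h set) add zero scl ip.
      hilbert_space V add zero scl ip \<and> gh_embeds X (hilbert_metric V add scl ip)}"
  \<comment> \<open>The bounding set mentions neither \<open>V\<close> nor the type
    \<open>'h\<close>, so one rare set handles all Hilbert spaces at once.\<close>
  have "?H \<subseteq> {X. gh_distance_matrices X \<subseteq> tripod_inequality}"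
    by (intro Collect_mono impI, elim exE conjE) (rule gh_embeds_hilbert_tripod_inequality)
  then have "rare ?H" by (rule rare_subset[OF rare_gh_tripod_inequality])
  then have "meager ?H" unfolding meager_def by (intro exI[of _ "{?H}"]) simp
  then show "residual {X. \<not> (\<exists>(V :: 'h set) add zero scl ip.
      hilbert_space V add zero scl ip \<and> gh_embeds X (hilbert_metric V add scl ip))}"
    unfolding residual_def Collect_neg_eq double_complement .
qed

end
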